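(* Let $\mathcal{L}$ be a second-order linear operator on $\mathbb{R}^N$ satisfying assumptions (H1), (H2), (H3), (FS), (G), (L) stated in the context. Let $u\in\underline{\mathcal{L}}_b(\mathbb{R}^N)$ and let $p\in(1,\infty)$ be arbitrarily fixed. Then there exists a $p_{\mathcal{L}}$-bounded set $F\subseteq\mathbb{R}^N$ such that $$\lim_{\substack{x\to\infty\\ x\notin F}}u(x)=\sup_{\mathbb{R}^N}u.$$
   Context: Operator: $\mathcal{L}=\frac{1}{V(x)}\sum_{i=1}^N\frac{\partial}{\partial x_i}\Big(\sum_{j=1}^N V(x)a_{i,j}(x)\frac{\partial}{\partial x_j}\Big)$ on $\mathbb{R}^N$, where: (H1) $V,a_{i,j}\in C^\infty(\mathbb{R}^N,\mathbb{R})$ for all $i,j$ and $V>0$ on $\mathbb{R}^N$; (H2) the matrix $A(x)=(a_{i,j}(x))_{i,j}$ is symmetric, positive semi-definite and $\mathrm{trace}(A(x))>0$ for every $x\in\mathbb{R}^N$; (H3) there is $\varepsilon>0$ such that both $\mathcal{L}$ and $\mathcal{L}-\varepsilon$ are $C^\infty$-hypoelliptic in every open subset of $\mathbb{R}^N$ (an operator $P$ is $C^\infty$-hypoelliptic in $\Omega$ if every distributional solution $u$ of $Pu=f$ is smooth in $\Omega$ whenever $f$ is smooth). (FS) There is a function $\Gamma:\{(x,y)\in\mathbb{R}^N\times\mathbb{R}^N:x\ne y\}\to\mathbb{R}$ which is $C^\infty$, strictly positive and symmetric, such that for every $x\in\mathbb{R}^N$: $\Gamma(x,\cdot)\in L^1_{\mathrm{loc}}(\mathbb{R}^N)$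 and $\int_{\mathbb{R}^N}\Gamma(x,y)\,\mathcal{L}\varphi(y)\,V(y)\,dy=-\varphi(x)$ for all $\varphi\in C_0^\infty(\mathbb{R}^N,\mathbb{R})$; $\lim_{y\to x}\Gamma(x,y)=\infty$; $\lim_{\|y\|\to\infty}\Gamma(x,y)=0$. Set $\gamma(x,y)=1/\Gamma(x,y)$ for $x\neq y$, $\gamma(x,x)=0$, and define the $\Gamma$-ball $\Omega(x,r)=\{y\in\mathbb{R}^N:\gamma(x,y)<r\}$ for $x\in\mathbb{R}^N$, $r>0$. (G) There is $\theta\in(0,1)$ such that $x\notin\Omega(y,r)$ implies $\Omega(x,\theta r)\cap\Omega(y,\theta r)=\varnothing$, for all $x,y\in\mathbb{R}^N$, $r>0$. (L) Every $\mathcal{L}$-harmonic function on $\mathbb{R}^N$ which is bounded from above (or from below) is constant. Potential theory: a function is $\mathcal{L}$-harmonic in an open set if it is a smooth solution of $\mathcal{L}u=0$ there. For $\Omega\subseteq\mathbb{R}^N$ open, an upper semicontinuous function $u:\Omega\to[-\infty,\infty)$ is $\mathcal{L}$-subharmonic in $\Omega$ if (i) $\{x\in\Omega:u(x)>-\infty\}$ is dense in $\Omega$; (ii) for every bounded open set $W$ with $\overline W\subseteq\Omega$ and every $h$ that is $\mathcal{L}$-harmonic in $W$, continuous up to $\partial W$ and satisfies $u\le h$ on $\partial W$, one has $u\le h$ in $W$. $\underline{\mathcal{L}}_b(\Omega)$ denotes the set of $\mathcal{L}$-subharmonic functions in $\Omega$ that are bounded above. $p_{\mathcal{L}}$-boundedness: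 for $p\in(1,\infty)$, $F\subseteq\mathbb{R}^N$ is $p_{\mathcal{L}}$-bounded if there is a countable family $\{\Omega(x_n,r_n)\}_{n\in J}$ of $\Gamma$-balls such that $F\subseteq\bigcup_{n\in J}\Omega(x_n,r_n)$ and $\sum_{n\in J}\big(r_n/\gamma(0,x_n)\big)^p<\infty$ (a term with $x_n=0$ counts as $+\infty$). *)

theory Defs
  imports "HOL-Analysis.Analysis"
begin

section \<open>Smooth functions and the operator\<close>

definition partial :: "'a::euclidean_space \<Rightarrow> ('a \<Rightarrow> real) \<Rightarrow> 'a \<Rightarrow> real" where
  "partial b f x = frechet_derivative f (at x) b"

text \<open>To be used on open sets only: derivatives are taken in the whole space.\<close>

primrec Ck_on :: "nat \<Rightarrow> 'a::euclidean_space set \<Rightarrow> ('a \<Rightarrow> real) \<Rightarrow> bool" where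
  "Ck_on 0 S f \<longleftrightarrow> continuous_on S f"
| "Ck_on (Suc k) S f \<longleftrightarrow>
     (\<forall>x\<in>S. f differentiable (at x)) \<and> (\<forall>b\<in>Basis. Ck_on k S (partial b f))"

definition smooth_on :: "'a::euclidean_space set \<Rightarrow> ('a \<Rightarrow> real) \<Rightarrow> bool" where
  "smooth_on S f \<longleftrightarrow> (\<forall>k. Ck_on k S f)"

abbreviation pd :: "'n::finite \<Rightarrow> (real^'n \<Rightarrow> real) \<Rightarrow> real^'n \<Rightarrow> real" where
  "pd i \<equiv> partial (axis i 1)"

definition Lop :: "(real^'n \<Rightarrow> real) \<Rightarrow> (real^'n \<Rightarrow> real^'n^'n) \<Rightarrow>
    (real^'n \<Rightarrow> real) \<Rightarrow> real^'n \<Rightarrow> real" where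
  "Lop V A u x =
     1 / V x * (\<Sum>i\<in>UNIV. pd i (\<lambda>y. \<Sum>j\<in>UNIV. V y * A y $ i $ j * pd j u y) x)"

definition test_fun :: "'a::euclidean_space set \<Rightarrow> ('a \<Rightarrow> real) \<Rightarrow> bool" where
  "test_fun \<Omega> \<phi> \<longleftrightarrow> smooth_on UNIV \<phi> \<and>
     compact (closure {x. \<phi> x \<noteq> 0}) \<and> closure {x. \<phi> x \<noteq> 0} \<subseteq> \<Omega>"

section \<open>Distributions and hypoellipticity\<close>

text \<open>
  A distribution on \<open>\<Omega>\<close> is a functional on all functions of which only the values on test
  functions on \<open>\<Omega>\<close> matter.  Multi-indices are represented by lists of basis vectors.
\<close>

type_synonym 'n functional = "(real^'n \<Rightarrow> real) \<Rightarrow> real"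

definition Ck_seminorm :: "nat \<Rightarrow> (real^'n \<Rightarrow> real) \<Rightarrow> real" where
  "Ck_seminorm k \<phi> =
     (\<Sum>bs\<in>{bs. set bs \<subseteq> Basis \<and> length bs \<le> k}. SUP x. \<bar>foldr partial bs \<phi> x\<bar>)"

definition distribution :: "(real^'n) set \<Rightarrow> 'n functional \<Rightarrow> bool" where
  "distribution \<Omega> T \<longleftrightarrow>
     (\<forall>\<phi> \<psi>. test_fun \<Omega> \<phi> \<longrightarrow> test_fun \<Omega> \<psi> \<longrightarrow> T (\<lambda>x. \<phi> x + \<psi> x) = T \<phi> + T \<psi>) \<and>
     (\<forall>c \<phi>. test_fun \<Omega> \<phi> \<longrightarrow> T (\<lambda>x. c * \<phi> x) = c * T \<phi>) \<and>
     (\<forall>K. compact K \<longrightarrow> K \<subseteq> \<Omega> \<longrightarrow>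
        (\<exists>C k. \<forall>\<phi>. test_fun \<Omega> \<phi> \<longrightarrow> closure {x. \<phi> x \<noteq> 0} \<subseteq> K \<longrightarrow>
           \<bar>T \<phi>\<bar> \<le> C * Ck_seminorm k \<phi>))"

definition distr_of_fun :: "(real^'n \<Rightarrow> real) \<Rightarrow> 'n functional" where
  "distr_of_fun f \<phi> = (\<integral>x. f x * \<phi> x \<partial>lborel)"

definition distr_pd :: "'n \<Rightarrow> 'n functional \<Rightarrow> 'n::finite functional" where
  "distr_pd i T \<phi> = - T (pd i \<phi>)"

definition distr_mult :: "(real^'n \<Rightarrow> real) \<Rightarrow> 'n functional \<Rightarrow> 'n functional" where
  "distr_mult g T \<phi> = T (\<lambda>x. g x * \<phi> x)"

definition distr_L :: "(real^'n \<Rightarrow> real) \<Rightarrow> (real^'n \<Rightarrow> real^'n^'n) \<Rightarrow>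
    'n functional \<Rightarrow> 'n functional" where
  "distr_L V A T = distr_mult (\<lambda>x. 1 / V x)
     (\<lambda>\<phi>. \<Sum>i\<in>UNIV. distr_pd i
        (\<lambda>\<psi>. \<Sum>j\<in>UNIV. distr_mult (\<lambda>x. V x * A x $ i $ j) (distr_pd j T) \<psi>) \<phi>)"

definition hypoelliptic_in :: "(real^'n) set \<Rightarrow> ('n functional \<Rightarrow> 'n functional) \<Rightarrow> bool" where
  "hypoelliptic_in \<Omega> P \<longleftrightarrow>
     (\<forall>T f. distribution \<Omega> T \<and> smooth_on \<Omega> f \<and>
        (\<forall>\<phi>. test_fun \<Omega> \<phi> \<longrightarrow> P T \<phi> = distr_of_fun f \<phi>) \<longrightarrow>
        (\<exists>w. smooth_on \<Omega> w \<and> (\<forall>\<phi>. test_fun \<Omega> \<phi> \<longrightarrow> T \<phi> = distr_of_fun w \<phi>)))"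

section \<open>Potential theory\<close>

definition L_harmonic_in :: "(real^'n \<Rightarrow> real) \<Rightarrow> (real^'n \<Rightarrow> real^'n^'n) \<Rightarrow>
    (real^'n) set \<Rightarrow> (real^'n \<Rightarrow> real) \<Rightarrow> bool" where
  "L_harmonic_in V A W h \<longleftrightarrow> smooth_on W h \<and> (\<forall>x\<in>W. Lop V A h x = 0)"

definition usc_on :: "'a::topological_space set \<Rightarrow> ('a \<Rightarrow> ereal) \<Rightarrow> bool" where
  "usc_on S u \<longleftrightarrow> (\<forall>c. openin (top_of_set S) {x\<in>S. u x < c})"

definition L_subharmonic_in :: "(real^'n \<Rightarrow> real) \<Rightarrow> (real^'n \<Rightarrow> real^'n^'n) \<Rightarrow>
    (real^'n) set \<Rightarrow> (real^'n \<Rightarrow> ereal) \<Rightarrow> bool" where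
  "L_subharmonic_in V A \<Omega> u \<longleftrightarrow>
     (\<forall>x\<in>\<Omega>. u x < \<infinity>) \<and> usc_on \<Omega> u \<and>
     \<Omega> \<subseteq> closure {x\<in>\<Omega>. u x > -\<infinity>} \<and>
     (\<forall>W h. open W \<longrightarrow> bounded W \<longrightarrow> closure W \<subseteq> \<Omega> \<longrightarrow>
        L_harmonic_in V A W h \<longrightarrow> continuous_on (closure W) h \<longrightarrow>
        (\<forall>x\<in>frontier W. u x \<le> ereal (h x)) \<longrightarrow> (\<forall>x\<in>W. u x \<le> ereal (h x)))"

definition L_subharmonic_bdd :: "(real^'n \<Rightarrow> real) \<Rightarrow> (real^'n \<Rightarrow> real^'n^'n) \<Rightarrow>
    (real^'n) set \<Rightarrow> (real^'n \<Rightarrow> ereal) set" where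
  "L_subharmonic_bdd V A \<Omega> =
     {u. L_subharmonic_in V A \<Omega> u \<and> (\<exists>M::real. \<forall>x\<in>\<Omega>. u x \<le> ereal M)}"

section \<open>Gamma-balls\<close>

text \<open>The values of \<open>\<Gamma>\<close> on the diagonal are irrelevant throughout.\<close>

definition gam :: "('a \<Rightarrow> 'a \<Rightarrow> real) \<Rightarrow> 'a \<Rightarrow> 'a \<Rightarrow> real" where
  "gam \<Gamma> x y = (if x = y then 0 else 1 / \<Gamma> x y)"

definition gball :: "('a \<Rightarrow> 'a \<Rightarrow> real) \<Rightarrow> 'a \<Rightarrow> real \<Rightarrow> 'a set" where
  "gball \<Gamma> x r = {y. gam \<Gamma> x y < r}"

definition pL_bounded :: "(real^'n \<Rightarrow> real^'n \<Rightarrow> real) \<Rightarrow> real \<Rightarrow> (real^'n) set \<Rightarrow> bool" where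
  "pL_bounded \<Gamma> p F \<longleftrightarrow>
     (\<exists>(J :: nat set) c r. (\<forall>n\<in>J. r n > 0) \<and> F \<subseteq> (\<Union>n\<in>J. gball \<Gamma> (c n) (r n)) \<and>
        (\<Sum>\<^sub>\<infinity>n\<in>J. if c n = 0 then (\<infinity>::ennreal)
                  else ennreal ((r n / gam \<Gamma> 0 (c n)) powr p)) < \<infinity>)"

section \<open>Standing assumptions\<close>

definition H1 :: "(real^'n \<Rightarrow> real) \<Rightarrow> (real^'n \<Rightarrow> real^'n^'n) \<Rightarrow> bool" where
  "H1 V A \<longleftrightarrow> smooth_on UNIV V \<and> (\<forall>i j. smooth_on UNIV (\<lambda>x. A x $ i $ j)) \<and> (\<forall>x. V x > 0)"

definition H2 :: "(real^'n \<Rightarrow> real^'n^'n) \<Rightarrow> bool" where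
  "H2 A \<longleftrightarrow> (\<forall>x. transpose (A x) = A x \<and> (\<forall>\<xi>. \<xi> \<bullet> (A x *v \<xi>) \<ge> 0) \<and> trace (A x) > 0)"

definition H3 :: "(real^'n \<Rightarrow> real) \<Rightarrow> (real^'n \<Rightarrow> real^'n^'n) \<Rightarrow> bool" where
  "H3 V A \<longleftrightarrow> (\<exists>\<epsilon>>0. \<forall>\<Omega>. open \<Omega> \<longrightarrow>
     hypoelliptic_in \<Omega> (distr_L V A) \<and>
     hypoelliptic_in \<Omega> (\<lambda>T \<phi>. distr_L V A T \<phi> - \<epsilon> * T \<phi>))"

definition FS :: "(real^'n \<Rightarrow> real) \<Rightarrow> (real^'n \<Rightarrow> real^'n^'n) \<Rightarrow>
    (real^'n \<Rightarrow> real^'n \<Rightarrow> real) \<Rightarrow> bool" where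
  "FS V A \<Gamma> \<longleftrightarrow>
     smooth_on {(x, y). x \<noteq> y} (\<lambda>(x, y). \<Gamma> x y) \<and>
     (\<forall>x y. x \<noteq> y \<longrightarrow> \<Gamma> x y > 0 \<and> \<Gamma> x y = \<Gamma> y x) \<and>
     (\<forall>x. (\<forall>K. compact K \<longrightarrow> set_integrable lborel K (\<Gamma> x)) \<and>
        (\<forall>\<phi>. test_fun UNIV \<phi> \<longrightarrow>
           (\<integral>y. \<Gamma> x y * Lop V A \<phi> y * V y \<partial>lborel) = - \<phi> x) \<and>
        filterlim (\<Gamma> x) at_top (at x) \<and>
        (\<Gamma> x \<longlongrightarrow> 0) at_infinity)"

definition G :: "(real^'n \<Rightarrow> real^'n \<Rightarrow> real) \<Rightarrow> bool" where
  "G \<Gamma> \<longleftrightarrow> (\<exists>\<theta>. 0 < \<theta> \<and> \<theta> < 1 \<and> (\<forall>x y r. r > 0 \<longrightarrow> x \<notin> gball \<Gamma> y r \<longrightarrow>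
     gball \<Gamma> x (\<theta> * r) \<inter> gball \<Gamma> y (\<theta> * r) = {}))"

definition Liouville :: "(real^'n \<Rightarrow> real) \<Rightarrow> (real^'n \<Rightarrow> real^'n^'n) \<Rightarrow> bool" where
  "Liouville V A \<longleftrightarrow> (\<forall>h. L_harmonic_in V A UNIV h \<longrightarrow>
     bdd_above (range h) \<or> bdd_below (range h) \<longrightarrow> h constant_on UNIV)"

section \<open>Limits at infinity outside an exceptional set\<close>

text \<open>
  As for every limit along a subset, infinity is required to be a limit point of the complement
  of \<open>F\<close>; without this the limit would hold vacuously, for instance, for \<open>F = UNIV\<close>.
\<close>

definition tendsto_at_infinity_off ::
    "('a::real_normed_vector \<Rightarrow> 'b::topological_space) \<Rightarrow> 'b \<Rightarrow> 'a set \<Rightarrow> bool" where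
  "tendsto_at_infinity_off u l F \<longleftrightarrow>
     \<not> bounded (- F) \<and> (u \<longlongrightarrow> l) (inf at_infinity (principal (- F)))"

end

theory Submission
  imports Defs
begin

text \<open>
  Neither a Riesz representation of \<open>u\<close> nor the Dirichlet problem is needed: \<open>u\<close> is compared
  directly with finite sums of the functions \<open>\<Gamma> (x n)\<close>.  Let \<open>U\<close> be the supremum of \<open>u\<close>.  The set
  \<open>E = {u < U - \<delta>}\<close> is open, so countably many small \<open>\<Gamma>\<close>-balls about points \<open>x n\<close> cover its part
  far from the origin and stay inside \<open>E\<close>.  A greedy Frostman construction puts masses \<open>m n\<close> at the
  points such that the potential \<open>P\<close> of finitely many of them is at most \<open>C (1 + S)\<close> off the balls,
  where \<open>S\<close> is its value at \<open>0\<close>, while Vitali's selection yields a cover by \<open>\<Gamma>\<close>-balls whose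
  \<open>p\<close>-sum is at most a multiple of \<open>sup S\<close>.  The comparison principle on \<open>{P > \<epsilon>}\<close> minus the balls
  gives \<open>u \<le> U - \<delta> P / (C (1 + S))\<close>.  At a point \<open>x0\<close> closer to the origin than all \<open>x n\<close>, \<open>P\<close> is
  comparable to \<open>S\<close>; since \<open>u x0\<close> may be taken arbitrarily close to \<open>U\<close>, the value \<open>S\<close>, and with
  it the \<open>p\<close>-sum, is as small as desired.  The exceptional set is the union of such sets over a
  sequence of levels, and the maximum principle on \<open>{gam \<Gamma> 0 < R}\<close> provides points off it near
  infinity.
\<close>

section \<open>Calculus of smooth functions\<close>

lemma partial_eq: "(f has_derivative f') (at x) \<Longrightarrow> partial b f x = f' b"
  unfolding partial_def by (metis frechet_derivative_at)

lemma has_derivative_frechet: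
  "f differentiable (at x) \<Longrightarrow> (f has_derivative frechet_derivative f (at x)) (at x)"
  by (simp add: frechet_derivative_works)

lemma partial_cong:
  assumes "open S" "x \<in> S" "\<And>y. y \<in> S \<Longrightarrow> f y = g y"
  shows "partial b f x = partial b g x"
proof -
  have "(f has_derivative f') (at x) \<longleftrightarrow> (g has_derivative f') (at x)" for f'
    using assms by (auto elim!: has_derivative_transform_within_open)
  then show ?thesis
    unfolding partial_def frechet_derivative_def by simp
qed

lemma differentiable_cong_open:
  assumes "open S" "x \<in> S" "\<And>y. y \<in> S \<Longrightarrow> f y = g y" "f differentiable (at x)"
  shows "g differentiable (at x)"
  using assms unfolding differentiable_def by (blast intro: has_derivative_transform_within_open)

lemma partial_add:
  "f differentiable (at x) \<Longrightarrow> g differentiable (at x) \<Longrightarrow>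
     partial b (\<lambda>y. f y + g y) x = partial b f x + partial b g x"
  by (subst partial_eq[OF has_derivative_add[OF has_derivative_frechet has_derivative_frechet]])
     (auto simp: partial_def)

lemma partial_diff:
  "f differentiable (at x) \<Longrightarrow> g differentiable (at x) \<Longrightarrow>
     partial b (\<lambda>y. f y - g y) x = partial b f x - partial b g x"
  by (subst partial_eq[OF has_derivative_diff[OF has_derivative_frechet has_derivative_frechet]])
     (auto simp: partial_def)

lemma partial_mult:
  "f differentiable (at x) \<Longrightarrow> g differentiable (at x) \<Longrightarrow>
     partial b (\<lambda>y. f y * g y) x = f x * partial b g x + partial b f x * g x"
  by (subst partial_eq[OF has_derivative_mult[OF has_derivative_frechet has_derivative_frechet]])
     (auto simp: partial_def)

lemma partial_const [simp]: "partial b (\<lambda>y. c) x = 0"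
  by (subst partial_eq[OF has_derivative_const]) auto

lemma partial_cmult:
  "f differentiable (at x) \<Longrightarrow> partial b (\<lambda>y. c * f y) x = c * partial b f x"
  by (subst partial_mult) auto

lemma Ck_on_cong:
  assumes "open S" "\<And>x. x \<in> S \<Longrightarrow> f x = g x" "Ck_on k S f"
  shows "Ck_on k S g"
  using assms(2,3)
proof (induction k arbitrary: f g)
  case 0
  then show ?case by (simp cong: continuous_on_cong)
next
  case (Suc k)
  have "Ck_on k S (partial b g)" if "b \<in> Basis" for b
    using Suc.IH[of "partial b f" "partial b g"] partial_cong[OF assms(1), of _ f g b] Suc.prems that
    by auto
  then show ?case
    using Suc.prems differentiable_cong_open[OF assms(1), of _ f g] by auto
qed

lemma Ck_on_subset: "Ck_on k S f \<Longrightarrow> T \<subseteq> S \<Longrightarrow> Ck_on k T f"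
  by (induction k arbitrary: f) (auto intro: continuous_on_subset)

lemma Ck_on_Un:
  "open S \<Longrightarrow> open T \<Longrightarrow> Ck_on k S f \<Longrightarrow> Ck_on k T f \<Longrightarrow> Ck_on k (S \<union> T) f"
  by (induction k arbitrary: f) (auto intro: continuous_on_open_Un)

lemma Ck_on_Suc_imp_Ck_on: "Ck_on (Suc k) S f \<Longrightarrow> Ck_on k S f"
proof (induction k arbitrary: f)
  case 0
  then show ?case
    by (auto intro!: continuous_at_imp_continuous_on differentiable_imp_continuous_within)
next
  case (Suc k)
  then show ?case by (metis Ck_on.simps(2))
qed

lemma Ck_on_const [simp]: "Ck_on k S (\<lambda>x. c)"
proof (induction k arbitrary: c)
  case (Suc k)
  have "partial b (\<lambda>x::'a. c) = (\<lambda>x. 0)" for b by (rule ext) simp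
  then show ?case using Suc by simp
qed simp

lemma Ck_on_add:
  "open S \<Longrightarrow> Ck_on k S f \<Longrightarrow> Ck_on k S g \<Longrightarrow> Ck_on k S (\<lambda>x. f x + g x)"
proof (induction k arbitrary: f g)
  case 0
  then show ?case by (auto intro: continuous_intros)
next
  case (Suc k)
  have "Ck_on k S (partial b (\<lambda>x. f x + g x))" if b: "b \<in> Basis" for b
  proof (rule Ck_on_cong[OF Suc.prems(1)])
    show "Ck_on k S (\<lambda>x. partial b f x + partial b g x)"
      using Suc b by auto
  qed (use Suc.prems in \<open>auto simp: partial_add\<close>)
  then show ?case using Suc.prems by auto
qed

lemma Ck_on_mult:
  "open S \<Longrightarrow> Ck_on k S f \<Longrightarrow> Ck_on k S g \<Longrightarrow> Ck_on k S (\<lambda>x. f x * g x)"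
proof (induction k arbitrary: f g)
  case 0
  then show ?case by (auto intro: continuous_intros)
next
  case (Suc k)
  have "Ck_on k S (partial b (\<lambda>x. f x * g x))" if b: "b \<in> Basis" for b
  proof (rule Ck_on_cong[OF Suc.prems(1)])
    show "Ck_on k S (\<lambda>x. f x * partial b g x + partial b f x * g x)"
      using Suc.prems b
      by (intro Ck_on_add Suc.IH) (auto intro: Ck_on_Suc_imp_Ck_on)
  qed (use Suc.prems in \<open>auto simp: partial_mult\<close>)
  then show ?case using Suc.prems by auto
qed

lemma Ck_on_sum:
  assumes "open S" "\<And>i. i \<in> I \<Longrightarrow> Ck_on k S (f i)"
  shows "Ck_on k S (\<lambda>x. \<Sum>i\<in>I. f i x)"
  using assms(2)
proof (induction I rule: infinite_finite_induct)
  case (insert i I)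
  then show ?case using Ck_on_add[OF assms(1), of k "f i"] by simp
qed simp_all

lemma Ck_on_cmult: "open S \<Longrightarrow> Ck_on k S f \<Longrightarrow> Ck_on k S (\<lambda>x. c * f x)"
  by (intro Ck_on_mult Ck_on_const)

lemma Ck_on_diff:
  "open S \<Longrightarrow> Ck_on k S f \<Longrightarrow> Ck_on k S g \<Longrightarrow> Ck_on k S (\<lambda>x. f x - g x)"
  using Ck_on_add[of S k f "\<lambda>x. (-1) * g x"] Ck_on_cmult[of S k g "-1"] by simp

lemma Ck_on_inner_const [simp]: "Ck_on k S (\<lambda>x. x \<bullet> a)"
proof (cases k)
  case (Suc m)
  have d: "((\<lambda>x. x \<bullet> a) has_derivative (\<lambda>x. x \<bullet> a)) (at x)" for x
    by (auto intro!: derivative_eq_intros)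
  have "partial b (\<lambda>x. x \<bullet> a) = (\<lambda>x. b \<bullet> a)" for b
    using partial_eq[OF d] by (intro ext) auto
  then show ?thesis using Suc d by (auto simp: differentiable_def)
qed (auto intro: continuous_intros)

text \<open>The chain rule replaces \<open>f\<close> by its derivative, so the induction runs over a
  whole family closed under differentiation. It is applied to the range of
  \<open>flat\<close>.\<close>

lemma Ck_on_compose:
  fixes \<F> :: "(real \<Rightarrow> real) set"
  assumes D: "\<And>f. f \<in> \<F> \<Longrightarrow> \<exists>f'\<in>\<F>. \<forall>t. (f has_real_derivative f' t) (at t)"
    and "open S" and q: "smooth_on S q" and "f \<in> \<F>"
  shows "Ck_on k S (\<lambda>x. f (q x))"
  using \<open>f \<in> \<F>\<close>
proof (induction k arbitrary: f)
  case 0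
  obtain f' where "\<forall>t. (f has_real_derivative f' t) (at t)" using D[OF 0] by blast
  then have "continuous_on UNIV f"
    using DERIV_isCont continuous_at_imp_continuous_on by blast
  moreover have "continuous_on S q" using q unfolding smooth_on_def by (metis Ck_on.simps(1))
  ultimately show ?case by (auto intro: continuous_on_compose2)
next
  case (Suc k)
  obtain f' where f': "f' \<in> \<F>" "\<And>t. (f has_real_derivative f' t) (at t)"
    using D[OF Suc.prems] by blast
  have q1: "Ck_on (Suc k) S q" using q unfolding smooth_on_def by blast
  have d: "((\<lambda>x. f (q x)) has_derivative (\<lambda>h. frechet_derivative q (at x) h * f' (q x))) (at x)"
    if "x \<in> S" for x
  proof -
    have "(q has_derivative frechet_derivative q (at x)) (at x)"
      using q1 that by (auto intro: has_derivative_frechet)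
    from has_derivative_compose[OF this, of f "(*) (f' (q x))"] show ?thesis
      using f'(2)[of "q x"] by (simp add: has_field_derivative_def mult.commute)
  qed
  have "Ck_on k S (partial b (\<lambda>x. f (q x)))" if b: "b \<in> Basis" for b
  proof (rule Ck_on_cong[OF \<open>open S\<close>])
    show "Ck_on k S (\<lambda>x. partial b q x * f' (q x))"
      using q1 b by (intro Ck_on_mult Suc.IH f'(1) \<open>open S\<close>) auto
    show "partial b q x * f' (q x) = partial b (\<lambda>x. f (q x)) x" if "x \<in> S" for x
      using partial_eq[OF d[OF that]] by (simp add: partial_def)
  qed
  then show ?case using d by (auto simp: differentiable_def)
qed

text \<open>The derivative of the slice in direction \<open>b\<close> is the slice of the derivative
  of \<open>F\<close> in direction \<open>(0, b)\<close>, again a basis vector. This turns joint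
  smoothness of \<Gamma> off the diagonal into smoothness of \<open>\<Gamma> x\<close> off
  \<open>x\<close>.\<close>

lemma Ck_on_slice:
  fixes F :: "'a::euclidean_space \<times> 'b::euclidean_space \<Rightarrow> real"
  assumes "open U" "Ck_on k U F"
  shows "Ck_on k {y. (a, y) \<in> U} (\<lambda>y. F (a, y))"
  using assms(2)
proof (induction k arbitrary: F)
  case 0
  then show ?case by (auto intro!: continuous_on_compose2[of U F] continuous_intros)
next
  case (Suc k)
  have op: "open {y. (a, y) \<in> U}"
    using open_vimage[OF assms(1), of "Pair a"]
    by (simp add: vimage_def continuous_on_Pair)
  have d: "((\<lambda>y. F (a, y)) has_derivative (\<lambda>h. frechet_derivative F (at (a, y)) (0, h))) (at y)"
    if "(a, y) \<in> U" for y
  proof -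
    have "(F has_derivative frechet_derivative F (at (a, y))) (at (a, y))"
      using Suc.prems that by (auto intro: has_derivative_frechet)
    moreover have "((\<lambda>y. (a, y)) has_derivative (\<lambda>h. (0, h))) (at y)"
      by (auto intro!: derivative_eq_intros)
    ultimately show ?thesis
      using has_derivative_compose[of "\<lambda>y. (a, y)" "\<lambda>h. (0, h)" y UNIV F] by simp
  qed
  have "Ck_on k {y. (a, y) \<in> U} (partial b (\<lambda>y. F (a, y)))" if b: "b \<in> Basis" for b
  proof (rule Ck_on_cong[OF op])
    show "Ck_on k {y. (a, y) \<in> U} (\<lambda>y. partial (0, b) F (a, y))"
      using Suc.prems b by (intro Suc.IH) (auto simp: Basis_prod_def)
  qed (use partial_eq[OF d] in \<open>auto simp: partial_def\<close>)
  then show ?case using d by (auto simp: differentiable_def)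
qed

lemma smooth_on_subset: "smooth_on S f \<Longrightarrow> T \<subseteq> S \<Longrightarrow> smooth_on T f"
  unfolding smooth_on_def by (blast intro: Ck_on_subset)

lemma smooth_on_const [simp]: "smooth_on S (\<lambda>x. c)"
  unfolding smooth_on_def by simp

lemma smooth_on_add:
  "open S \<Longrightarrow> smooth_on S f \<Longrightarrow> smooth_on S g \<Longrightarrow> smooth_on S (\<lambda>x. f x + g x)"
  unfolding smooth_on_def by (blast intro: Ck_on_add)

lemma smooth_on_diff:
  "open S \<Longrightarrow> smooth_on S f \<Longrightarrow> smooth_on S g \<Longrightarrow> smooth_on S (\<lambda>x. f x - g x)"
  unfolding smooth_on_def by (blast intro: Ck_on_diff)

lemma smooth_on_mult:
  "open S \<Longrightarrow> smooth_on S f \<Longrightarrow> smooth_on S g \<Longrightarrow> smooth_on S (\<lambda>x. f x * g x)"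
  unfolding smooth_on_def by (blast intro: Ck_on_mult)

lemma smooth_on_sum:
  "open S \<Longrightarrow> (\<And>i. i \<in> I \<Longrightarrow> smooth_on S (f i)) \<Longrightarrow> smooth_on S (\<lambda>x. \<Sum>i\<in>I. f i x)"
  unfolding smooth_on_def by (blast intro: Ck_on_sum)

lemma smooth_on_partial: "smooth_on S f \<Longrightarrow> b \<in> Basis \<Longrightarrow> smooth_on S (partial b f)"
  unfolding smooth_on_def by (metis Ck_on.simps(2))

lemma smooth_on_imp_differentiable: "smooth_on S f \<Longrightarrow> x \<in> S \<Longrightarrow> f differentiable (at x)"
  unfolding smooth_on_def by (metis Ck_on.simps(2))

lemma smooth_on_imp_continuous_on: "smooth_on S f \<Longrightarrow> continuous_on S f"
  unfolding smooth_on_def by (metis Ck_on.simps(1))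

section \<open>Bump functions\<close>

text \<open>Admitting all polynomials \<open>q\<close> makes this family closed under
  differentiation; \<open>flat 1\<close> is the classical smooth function that vanishes to infinite
  order at 0.\<close>

definition flat :: "real poly \<Rightarrow> real \<Rightarrow> real" where
  "flat q t = (if 0 < t then poly q (1 / t) * exp (- (1 / t)) else 0)"

lemma poly_exp_tendsto_0: "((\<lambda>s. poly q s * exp (- s)) \<longlongrightarrow> (0::real)) at_top"
proof -
  have "((\<lambda>s. \<Sum>i\<le>degree q. coeff q i * (s ^ i / exp s)) \<longlongrightarrow> (\<Sum>i\<le>degree q. coeff q i * 0)) at_top"
    by (intro tendsto_intros tendsto_power_div_exp_0)
  moreover have "(\<lambda>s. \<Sum>i\<le>degree q. coeff q i * (s ^ i / exp s)) = (\<lambda>s. poly q s * exp (- s))"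
    by (simp add: poly_altdef sum_distrib_right exp_minus divide_inverse mult.assoc)
  ultimately show ?thesis by simp
qed

lemma flat_tendsto_0: "(flat q \<longlongrightarrow> 0) (at 0)"
proof -
  have "((\<lambda>t. poly q (1 / t) * exp (- (1 / t))) \<longlongrightarrow> 0) (at_right 0)"
    using filterlim_compose[OF poly_exp_tendsto_0 filterlim_inverse_at_top_right, of q]
    by (simp add: inverse_eq_divide)
  then have "(flat q \<longlongrightarrow> 0) (at_right 0)"
    by (rule Lim_transform_eventually)
       (auto simp: flat_def eventually_at_right_less intro: eventually_mono[OF eventually_at_right_less])
  moreover have "(flat q \<longlongrightarrow> 0) (at_left 0)"
    by (rule Lim_transform_eventually[OF tendsto_const])
       (auto simp: flat_def eventually_at_filter)
  ultimately show ?thesis by (simp add: filterlim_split_at)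
qed

text \<open>With s = 1/t one has ds/dt = -s^2, so q(s) exp(-s) has the derivative s^2 (q(s) - q'(s))
  exp(-s); the polynomial \<open>[:0, 0, 1:]\<close> is s^2.\<close>

lemma flat_has_derivative:
  "(flat q has_real_derivative flat ([:0, 0, 1:] * (q - pderiv q)) t) (at t)"
proof -
  consider "t < 0" | "t = 0" | "t > 0" by linarith
  then show ?thesis
  proof cases
    case 1
    have "((\<lambda>x. 0) has_real_derivative 0) (at t)" by simp
    then have "(flat q has_real_derivative 0) (at t)"
      by (rule has_field_derivative_transform_within_open[of _ _ _ "{..<0}"])
         (use 1 in \<open>auto simp: flat_def\<close>)
    then show ?thesis using 1 by (simp add: flat_def)
  next
    case 2
    \<comment> \<open>Dividing by h multiplies the polynomial by its variable 1/h, so the difference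
      quotient at 0 is itself a member of the family and tends to 0.\<close>
    have "(\<lambda>h. (flat q (0 + h) - flat q 0) / h) = flat (pCons 0 q)"
      by (auto simp: flat_def fun_eq_iff)
    then have "(flat q has_real_derivative 0) (at 0)"
      unfolding DERIV_def using flat_tendsto_0[of "pCons 0 q"] by simp
    then show ?thesis using 2 by (simp add: flat_def)
  next
    case 3
    have "((\<lambda>x. poly q (1 / x) * exp (- (1 / x))) has_real_derivative
        flat ([:0, 0, 1:] * (q - pderiv q)) t) (at t)"
      using 3 unfolding flat_def
      by (auto intro!: derivative_eq_intros DERIV_chain2[OF poly_DERIV] simp: field_simps power2_eq_square)
    then show ?thesis
      by (rule has_field_derivative_transform_within_open[of _ _ _ "{0<..}"])
         (use 3 in \<open>auto simp: flat_def\<close>)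
  qed
qed

lemma bump_function_exists:
  fixes a :: "'a::euclidean_space"
  assumes "0 < r"
  obtains \<phi> :: "'a \<Rightarrow> real" where "smooth_on UNIV \<phi>" "\<And>x. 0 \<le> \<phi> x" "{x. \<phi> x \<noteq> 0} = ball a r"
proof
  \<comment> \<open>The function r^2 - |x - a|^2, written in coordinates so that the algebraic rules
    give its smoothness; it is positive exactly on the open ball.\<close>
  define q where "q x = r\<^sup>2 - (\<Sum>b\<in>Basis. (x \<bullet> b - a \<bullet> b) * (x \<bullet> b - a \<bullet> b))" for x
  let ?\<phi> = "\<lambda>x. flat 1 (q x)"
  have q: "q x = r\<^sup>2 - (norm (x - a))\<^sup>2" for x
    unfolding q_def by (subst power2_norm_eq_inner, subst euclidean_inner) (simp add: inner_diff_left)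
  have "smooth_on UNIV q"
    unfolding q_def smooth_on_def by (intro allI Ck_on_diff Ck_on_sum Ck_on_mult) auto
  then show "smooth_on UNIV ?\<phi>"
    unfolding smooth_on_def[of _ ?\<phi>] using flat_has_derivative
    by (intro allI Ck_on_compose[where \<F> = "range flat"]) auto
  show "0 \<le> ?\<phi> x" for x by (simp add: flat_def)
  have "(0 < q x) = (dist a x < r)" for x
  proof -
    have "r\<^sup>2 \<le> (norm (x - a))\<^sup>2 \<longleftrightarrow> r \<le> norm (x - a)"
      using assms abs_le_square_iff[of r "norm (x - a)"] by simp
    then show ?thesis
      unfolding q dist_norm norm_minus_commute[of a x] by linarith
  qed
  then have "?\<phi> x \<noteq> 0 \<longleftrightarrow> x \<in> ball a r" for x
    by (simp add: flat_def)
  then show "{x. ?\<phi> x \<noteq> 0} = ball a r" by blast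
qed

section \<open>Integration by parts\<close>

lemma integral_translation:
  fixes f :: "'a::euclidean_space \<Rightarrow> real"
  assumes "f \<in> borel_measurable borel"
  shows "(\<integral>x. f (x + a) \<partial>lborel) = (\<integral>x. f x \<partial>lborel)"
proof -
  have "(\<integral>x. f x \<partial>distr lborel borel ((+) a)) = (\<integral>x. f (a + x) \<partial>lborel)"
    using assms by (intro integral_distr) auto
  then show ?thesis by (simp add: lborel_distr_plus add.commute)
qed

lemma integrable_translation:
  fixes f :: "'a::euclidean_space \<Rightarrow> real"
  assumes "integrable lborel f"
  shows "integrable lborel (\<lambda>x. f (x + a))"
proof -
  have "integrable (distr lborel borel ((+) a)) f"
    using assms by (simp add: lborel_distr_plus)
  moreover have "f \<in> borel_measurable borel" using assms by auto
  ultimately show ?thesis by (subst (asm) integrable_distr_eq) (auto simp: add.commute)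
qed

lemma integrable_continuous_bounded_support:
  fixes f :: "'a::euclidean_space \<Rightarrow> real"
  assumes "continuous_on UNIV f" "\<And>x. x \<notin> cball 0 M \<Longrightarrow> f x = 0"
  shows "integrable lborel f"
proof -
  have "integrable lborel (\<lambda>x. indicat_real (cball 0 M) x *\<^sub>R f x)"
    using assms(1) by (intro borel_integrable_compact) (auto intro: continuous_on_subset)
  moreover have "(\<lambda>x. indicat_real (cball 0 M) x *\<^sub>R f x) = f"
    using assms(2) by (auto simp: indicator_def fun_eq_iff)
  ultimately show ?thesis by simp
qed

text \<open>By translation invariance every difference quotient of \<open>f\<close> in direction
  \<open>b\<close> has integral 0; dominated convergence carries this over to the
  derivative.\<close>

lemma integral_partial_eq_0:
  fixes f :: "'a::euclidean_space \<Rightarrow> real"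
  assumes C1: "Ck_on 1 UNIV f" and b: "b \<in> Basis" and supp: "\<And>x. x \<notin> cball 0 M \<Longrightarrow> f x = 0"
  shows "integrable lborel (partial b f)" "(\<integral>x. partial b f x \<partial>lborel) = 0"
proof -
  have diff: "f differentiable (at x)" for x using C1 by simp
  have cf: "continuous_on UNIV f" using Ck_on_Suc_imp_Ck_on[of 0 UNIV f] C1 by simp
  have cp: "continuous_on UNIV (partial b f)" using C1 b by simp
  have supp': "partial b f x = 0" if "x \<notin> cball 0 M" for x
    using partial_cong[of "- cball 0 M" x f "\<lambda>_. 0" b] that supp by (simp add: open_Compl)
  show int: "integrable lborel (partial b f)"
    using integrable_continuous_bounded_support[OF cp supp'] .
  have intf: "integrable lborel f"
    using integrable_continuous_bounded_support[OF cf supp] .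
  have "bounded (partial b f ` cball 0 M)"
    by (intro compact_imp_bounded compact_continuous_image continuous_on_subset[OF cp]) auto
  then obtain B where B: "0 < B" "\<And>x. x \<in> cball 0 M \<Longrightarrow> \<bar>partial b f x\<bar> \<le> B"
    by (auto simp: bounded_pos)
  have B': "\<bar>partial b f x\<bar> \<le> B" for x
    using B supp'[of x] by (cases "x \<in> cball 0 M") auto
  have line: "((\<lambda>s. f (x + s *\<^sub>R b)) has_real_derivative partial b f (x + s *\<^sub>R b)) (at s)" for x s
  proof -
    have "((\<lambda>s. x + s *\<^sub>R b) has_derivative (\<lambda>h. h *\<^sub>R b)) (at s)"
      by (auto intro!: derivative_eq_intros)
    from has_derivative_compose[OF this has_derivative_frechet[OF diff]]
    have "((\<lambda>s. f (x + s *\<^sub>R b)) has_derivative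
       (\<lambda>h. frechet_derivative f (at (x + s *\<^sub>R b)) (h *\<^sub>R b))) (at s)" .
    moreover have "frechet_derivative f (at (x + s *\<^sub>R b)) (h *\<^sub>R b) = partial b f (x + s *\<^sub>R b) * h" for h
      using linear_frechet_derivative[OF diff] by (simp add: partial_def linear_scale)
    ultimately show ?thesis by (simp add: has_field_derivative_def)
  qed
  define t where "t n = inverse (real (Suc n))" for n
  have t: "0 < t n" "t n \<le> 1" for n by (auto simp: t_def divide_simps)
  define q where "q n x = (f (x + t n *\<^sub>R b) - f x) / t n" for n x
  have q0: "(\<integral>x. q n x \<partial>lborel) = 0" for n
    unfolding q_def using intf integrable_translation[OF intf] integral_translation[of f]
    by (simp add: Bochner_Integration.integral_diff)
  \<comment> \<open>The increments \<open>t n\<close> are at most 1 and \<open>b\<close> is a unit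
    vector, so all quotients vanish off the ball of radius M + 1; on it the mean value theorem
    bounds them by \<open>B\<close>.\<close>
  have lim: "(\<lambda>n. \<integral>x. q n x \<partial>lborel) \<longlonglongrightarrow> (\<integral>x. partial b f x \<partial>lborel)"
  proof (rule integral_dominated_convergence[where w = "\<lambda>x. B * indicator (cball 0 (M + 1)) x"])
    show "partial b f \<in> borel_measurable lborel" using int by auto
    show "q n \<in> borel_measurable lborel" for n
      unfolding q_def using intf integrable_translation[OF intf] by auto
    show "integrable lborel (\<lambda>x::'a. B * indicator (cball 0 (M + 1)) x)"
      using emeasure_bounded_finite[of "cball 0 (M + 1) :: 'a set"]
      by (intro integrable_mult_right integrable_real_indicator) auto
    show "AE x in lborel. (\<lambda>n. q n x) \<longlonglongrightarrow> partial b f x"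
    proof (rule AE_I2)
      fix x
      have "((\<lambda>h. (f (x + (0 + h) *\<^sub>R b) - f (x + 0 *\<^sub>R b)) / h) \<longlongrightarrow> partial b f (x + 0 *\<^sub>R b)) (at 0)"
        using line[of x 0] unfolding DERIV_def .
      moreover have "filterlim t (at 0) sequentially"
        unfolding filterlim_at t_def using LIMSEQ_inverse_real_of_nat by auto
      ultimately show "(\<lambda>n. q n x) \<longlonglongrightarrow> partial b f x"
        unfolding q_def by (auto dest: filterlim_compose)
    qed
    show "AE x in lborel. norm (q n x) \<le> B * indicator (cball 0 (M + 1)) x" for n
    proof (rule AE_I2)
      fix x
      show "norm (q n x) \<le> B * indicator (cball 0 (M + 1)) x"
      proof (cases "x \<in> cball 0 (M + 1)")
        case True
        obtain z where "f (x + t n *\<^sub>R b) - f (x + 0 *\<^sub>R b) = (t n - 0) * partial b f (x + z *\<^sub>R b)"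
          using MVT2[OF t(1)[of n], of "\<lambda>s. f (x + s *\<^sub>R b)" "\<lambda>s. partial b f (x + s *\<^sub>R b)"] line by blast
        then have "q n x = partial b f (x + z *\<^sub>R b)" using t[of n] by (simp add: q_def)
        then show ?thesis using B' True by simp
      next
        case False
        have "norm x - norm (t n *\<^sub>R b) \<le> norm (x + t n *\<^sub>R b)"
          by (metis add.commute norm_diff_ineq)
        then have "f (x + t n *\<^sub>R b) = 0"
          using False t[of n] b by (intro supp) (auto simp: not_le)
        moreover have "f x = 0" using False by (intro supp) auto
        ultimately show ?thesis using False by (simp add: q_def)
      qed
    qed
  qed
  then show "(\<integral>x. partial b f x \<partial>lborel) = 0"
    using q0 by (simp add: LIMSEQ_const_iff)
qed

text \<open>If the integral were 0, the nonempty open set of points of \<open>U\<close> where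
  \<open>f\<close> is positive would be a null set.\<close>

lemma integral_continuous_pos:
  fixes f :: "'a::euclidean_space \<Rightarrow> real"
  assumes "integrable lborel f" "\<And>x. 0 \<le> f x" "continuous_on U f" "open U" "a \<in> U" "0 < f a"
  shows "0 < (\<integral>x. f x \<partial>lborel)"
proof (rule ccontr)
  assume "\<not> 0 < (\<integral>x. f x \<partial>lborel)"
  then have "(\<integral>x. f x \<partial>lborel) = 0"
    using Bochner_Integration.integral_nonneg[of lborel f] assms(2) by (simp add: order_antisym)
  then have "AE x in lborel. f x = 0"
    using integral_nonneg_eq_0_iff_AE[OF assms(1)] assms(2) by auto
  moreover have "open {x \<in> U. 0 < f x}"
    using continuous_open_preimage[OF assms(3,4), of "{0<..}"] by (simp add: vimage_def Int_def)
  moreover have "AE x in lborel. x \<notin> {x \<in> U. 0 < f x}" if "AE x in lborel. f x = 0"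
    using that by eventually_elim auto
  ultimately have "{x \<in> U. 0 < f x} \<in> null_sets lborel"
    by (subst AE_iff_null_sets) auto
  then have "negligible {x \<in> U. 0 < f x}"
    by (simp add: negligible_iff_null_sets null_sets_completionI)
  then show False
    using open_not_negligible[OF \<open>open {x \<in> U. 0 < f x}\<close>] assms(5,6) by blast
qed

section \<open>Harmonic functions\<close>

text \<open>The components of the vector field V A grad u, whose divergence is \<open>V\<close>
  times the operator applied to \<open>u\<close>.\<close>

definition flux :: "(real^'n \<Rightarrow> real) \<Rightarrow> (real^'n \<Rightarrow> real^'n^'n) \<Rightarrow>
    (real^'n \<Rightarrow> real) \<Rightarrow> 'n \<Rightarrow> real^'n \<Rightarrow> real" where
  "flux V A u i = (\<lambda>y. \<Sum>j\<in>UNIV. V y * A y $ i $ j * pd j u y)"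

lemma Lop_flux: "Lop V A u x = 1 / V x * (\<Sum>i\<in>UNIV. pd i (flux V A u i) x)"
  by (simp add: Lop_def flux_def)

lemma axis_Basis [simp]: "axis i (1::real) \<in> Basis"
  by (simp add: axis_in_Basis_iff)

lemma smooth_on_flux:
  assumes "H1 V A" "open S" "smooth_on S u"
  shows "smooth_on S (flux V A u i)"
  unfolding flux_def using assms
  by (intro smooth_on_sum smooth_on_mult smooth_on_partial)
     (auto simp: H1_def intro: smooth_on_subset)

lemma flux_cong:
  assumes "open S" "y \<in> S" "\<And>x. x \<in> S \<Longrightarrow> f x = g x"
  shows "flux V A f i y = flux V A g i y"
  unfolding flux_def using partial_cong[OF assms] by simp

lemma Lop_cong:
  assumes "open S" "y \<in> S" "\<And>x. x \<in> S \<Longrightarrow> f x = g x"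
  shows "Lop V A f y = Lop V A g y"
  unfolding Lop_flux
  using partial_cong[OF assms(1,2), of "flux V A f _" "flux V A g _"] flux_cong[OF assms(1) _ assms(3)]
  by simp

lemma flux_const [simp]: "flux V A (\<lambda>x. c) i = (\<lambda>x. 0)"
  by (simp add: flux_def)

lemma Lop_const [simp]: "Lop V A (\<lambda>x. c) y = 0"
  by (simp add: Lop_flux)

lemma Lop_add:
  assumes "H1 V A" "open S" "smooth_on S f" "smooth_on S g" "y \<in> S"
  shows "Lop V A (\<lambda>x. f x + g x) y = Lop V A f y + Lop V A g y"
proof -
  have "flux V A (\<lambda>x. f x + g x) i z = flux V A f i z + flux V A g i z" if "z \<in> S" for i z
    unfolding flux_def using smooth_on_imp_differentiable[OF _ that] assms(3,4)
    by (simp add: partial_add distrib_left sum.distrib)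
  then have "pd i (flux V A (\<lambda>x. f x + g x) i) y = pd i (\<lambda>z. flux V A f i z + flux V A g i z) y" for i
    by (intro partial_cong[OF assms(2,5)])
  also have "\<dots> i = pd i (flux V A f i) y + pd i (flux V A g i) y" for i
    using smooth_on_imp_differentiable[OF smooth_on_flux[OF assms(1,2)] assms(5)] assms(3,4)
    by (simp add: partial_add)
  finally show ?thesis by (simp add: Lop_flux sum.distrib distrib_left add_divide_distrib)
qed

lemma Lop_cmult:
  assumes "H1 V A" "open S" "smooth_on S f" "y \<in> S"
  shows "Lop V A (\<lambda>x. c * f x) y = c * Lop V A f y"
proof -
  have "flux V A (\<lambda>x. c * f x) i z = c * flux V A f i z" if "z \<in> S" for i z
    unfolding flux_def using smooth_on_imp_differentiable[OF assms(3) that]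
    by (simp add: partial_cmult sum_distrib_left mult_ac)
  then have "pd i (flux V A (\<lambda>x. c * f x) i) y = pd i (\<lambda>z. c * flux V A f i z) y" for i
    by (intro partial_cong[OF assms(2,4)])
  also have "\<dots> i = c * pd i (flux V A f i) y" for i
    using smooth_on_imp_differentiable[OF smooth_on_flux[OF assms(1,2,3)] assms(4)]
    by (simp add: partial_cmult)
  finally show ?thesis by (simp add: Lop_flux sum_distrib_left mult_ac sum_divide_distrib)
qed

lemma L_harmonic_in_const [simp]: "L_harmonic_in V A S (\<lambda>x. c)"
  by (simp add: L_harmonic_in_def)

lemma L_harmonic_in_add:
  "H1 V A \<Longrightarrow> open S \<Longrightarrow> L_harmonic_in V A S f \<Longrightarrow> L_harmonic_in V A S g \<Longrightarrow>
     L_harmonic_in V A S (\<lambda>x. f x + g x)"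
  by (auto simp: L_harmonic_in_def smooth_on_add Lop_add)

lemma L_harmonic_in_cmult:
  "H1 V A \<Longrightarrow> open S \<Longrightarrow> L_harmonic_in V A S f \<Longrightarrow> L_harmonic_in V A S (\<lambda>x. c * f x)"
  by (auto simp: L_harmonic_in_def smooth_on_mult Lop_cmult)

lemma L_harmonic_in_sum:
  assumes "H1 V A" "open S" "\<And>i. i \<in> I \<Longrightarrow> L_harmonic_in V A S (f i)"
  shows "L_harmonic_in V A S (\<lambda>x. \<Sum>i\<in>I. f i x)"
  using assms(3)
proof (induction I rule: infinite_finite_induct)
  case (insert i I)
  then show ?case using L_harmonic_in_add[OF assms(1,2), of "f i"] by simp
qed simp_all

lemma L_harmonic_in_subset: "L_harmonic_in V A S f \<Longrightarrow> T \<subseteq> S \<Longrightarrow> L_harmonic_in V A T f"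
  by (auto simp: L_harmonic_in_def intro: smooth_on_subset)

text \<open>Expanding the divergence produces two sums of products of first derivatives with
  opposite signs; they cancel by the symmetry of \<open>A y\<close>.\<close>

lemma Green_identity:
  assumes H1: "H1 V A" and H2: "H2 A" and S: "open S" "y \<in> S"
    and f: "smooth_on S f" and g: "smooth_on S g"
  shows "(\<Sum>i\<in>UNIV. pd i (\<lambda>z. f z * flux V A g i z - g z * flux V A f i z) y)
    = f y * Lop V A g y * V y - g y * (V y * Lop V A f y)"
proof -
  note d = smooth_on_imp_differentiable[OF _ S(2)]
  have df: "f differentiable (at y)" and dg: "g differentiable (at y)"
    using d f g by auto
  have dff: "flux V A f i differentiable (at y)" and dfg: "flux V A g i differentiable (at y)" for i
    using d smooth_on_flux[OF H1 S(1)] f g by auto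
  have sym: "A y $ i $ j = A y $ j $ i" for i j
  proof -
    have "A y $ i $ j = transpose (A y) $ i $ j" using H2 by (simp add: H2_def)
    then show ?thesis by (simp add: transpose_def)
  qed
  have "(\<Sum>i\<in>UNIV. pd i f y * flux V A g i y) = (\<Sum>i\<in>UNIV. \<Sum>j\<in>UNIV. V y * A y $ i $ j * pd i f y * pd j g y)"
    by (simp add: flux_def sum_distrib_left mult_ac)
  also have "\<dots> = (\<Sum>j\<in>UNIV. \<Sum>i\<in>UNIV. V y * A y $ i $ j * pd i f y * pd j g y)"
    by (rule sum.swap)
  also have "\<dots> = (\<Sum>i\<in>UNIV. pd i g y * flux V A f i y)"
    unfolding flux_def sum_distrib_left
    by (intro sum.cong refl) (subst sym, simp add: mult_ac)
  finally have cross: "(\<Sum>i\<in>UNIV. pd i f y * flux V A g i y) = (\<Sum>i\<in>UNIV. pd i g y * flux V A f i y)" .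
  have "pd i (\<lambda>z. f z * flux V A g i z - g z * flux V A f i z) y =
      f y * pd i (flux V A g i) y - g y * pd i (flux V A f i) y
      + (pd i f y * flux V A g i y - pd i g y * flux V A f i y)" for i
    using df dg dff dfg by (simp add: partial_diff partial_mult)
  then have "(\<Sum>i\<in>UNIV. pd i (\<lambda>z. f z * flux V A g i z - g z * flux V A f i z) y)
    = f y * (\<Sum>i\<in>UNIV. pd i (flux V A g i) y) - g y * (\<Sum>i\<in>UNIV. pd i (flux V A f i) y)"
    by (simp add: sum.distrib sum_subtractf sum_distrib_left cross)
  moreover have "V y \<noteq> 0" using H1 by (metis H1_def less_irrefl)
  ultimately show ?thesis by (simp add: Lop_flux)
qed

section \<open>The fundamental solution away from its pole\<close>

lemma smooth_on_Gamma:
  fixes \<Gamma> :: "real^'n \<Rightarrow> real^'n \<Rightarrow> real"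
  assumes "FS V A \<Gamma>"
  shows "smooth_on (- {x}) (\<Gamma> x)"
proof -
  define U where "U = {p :: (real^'n) \<times> (real^'n). fst p \<noteq> snd p}"
  have "open U"
    unfolding U_def by (intro open_Collect_neq continuous_intros)
  moreover have "U = {(x, y). x \<noteq> y}" by (auto simp: U_def)
  then have "Ck_on k U (\<lambda>(x, y). \<Gamma> x y)" for k
    using assms by (simp add: FS_def smooth_on_def)
  ultimately have "Ck_on k {y. (x, y) \<in> U} (\<Gamma> x)" for k
    using Ck_on_slice[of U k "\<lambda>(x, y). \<Gamma> x y" x] by simp
  moreover have "{y. (x, y) \<in> U} = - {x}" by (auto simp: U_def)
  ultimately show ?thesis by (simp add: smooth_on_def)
qed

text \<open>(FS) describes \<open>Lop V A (\<Gamma> x)\<close> only weakly. If it were nonzero at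
  some a \<noteq> x, it would have constant sign near \<open>a\<close>. For a bump function \<phi>
  supported there, Green's identity turns the representation formula into the vanishing of the
  integral of \<open>\<phi> y * f y\<close>, a contradiction.\<close>

lemma L_harmonic_in_Gamma:
  assumes H1: "H1 V A" and H2: "H2 A" and FS: "FS V A \<Gamma>"
  shows "L_harmonic_in V A (- {x}) (\<Gamma> x)"
  unfolding L_harmonic_in_def
proof (intro conjI ballI)
  note sm = smooth_on_Gamma[OF FS, of x]
  show "smooth_on (- {x}) (\<Gamma> x)" by (fact sm)
  fix a assume "a \<in> - {x}"
  then have ax: "a \<noteq> x" by simp
  have op: "open (- {x})" by auto
  define f where "f y = V y * Lop V A (\<Gamma> x) y" for y
  have V0: "V y > 0" for y using H1 by (simp add: H1_def)
  have f: "f = (\<lambda>y. \<Sum>i\<in>UNIV. pd i (flux V A (\<Gamma> x) i) y)"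
    using V0 by (simp add: f_def Lop_flux fun_eq_iff less_imp_neq[symmetric])
  have "smooth_on (- {x}) f"
    unfolding f using smooth_on_flux[OF H1 op sm]
    by (intro smooth_on_sum op smooth_on_partial) auto
  then have cf: "continuous_on (- {x}) f" by (rule smooth_on_imp_continuous_on)
  show "Lop V A (\<Gamma> x) a = 0"
  proof (rule ccontr)
    assume "Lop V A (\<Gamma> x) a \<noteq> 0"
    then have fa: "f a \<noteq> 0" using V0[of a] by (simp add: f_def)
    define \<sigma> where "\<sigma> = sgn (f a)"
    have "continuous_on (- {x}) (\<lambda>y. \<sigma> * f y)"
      using cf by (intro continuous_intros)
    then have "open {y \<in> - {x}. 0 < \<sigma> * f y}"
      using continuous_open_preimage[of "- {x}" "\<lambda>y. \<sigma> * f y" "{0<..}"] op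
      by (simp add: vimage_def Int_def)
    moreover have "a \<in> {y \<in> - {x}. 0 < \<sigma> * f y}"
      using fa ax by (auto simp: \<sigma>_def sgn_real_def)
    ultimately obtain r where r: "0 < r" "cball a r \<subseteq> {y \<in> - {x}. 0 < \<sigma> * f y}"
      using open_contains_cball by blast
    obtain \<phi> where \<phi>: "smooth_on UNIV \<phi>" "\<And>x. 0 \<le> \<phi> x" "{x. \<phi> x \<noteq> 0} = ball a r"
      using bump_function_exists[OF r(1), of a] by blast
    define K where "K = cball a r"
    have opK: "open (- K)" by (auto simp: K_def)
    have \<phi>K: "\<phi> y = 0" if "y \<in> - K" for y
      using that \<phi>(3) ball_subset_cball[of a r] unfolding K_def by blast
    have xK: "x \<in> - K" using r(2) by (auto simp: K_def)
    have un: "- {x} \<union> - K = UNIV" using xK by auto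
    have "test_fun UNIV \<phi>" using \<phi>(1,3) r(1) by (simp add: test_fun_def)
    then have rep: "(\<integral>y. \<Gamma> x y * Lop V A \<phi> y * V y \<partial>lborel) = 0"
      using FS \<phi>K[OF xK] by (simp add: FS_def)
    define F where "F i y = \<Gamma> x y * flux V A \<phi> i y - \<phi> y * flux V A (\<Gamma> x) i y" for i y
    have FK: "F i y = 0" if "y \<in> - K" for i y
      using flux_cong[OF opK that \<phi>K] \<phi>K[OF that] by (simp add: F_def)
    define M where "M = norm a + r"
    have KM: "y \<in> - K" if "y \<notin> cball 0 M" for y
    proof -
      have "norm y \<le> norm a + dist a y" by (metis dist_norm norm_minus_commute norm_triangle_sub)
      then show ?thesis using that by (auto simp: K_def M_def)
    qed
    \<comment> \<open>\<open>F i\<close> is smooth off \<open>x\<close> and identically 0 off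
      \<open>K\<close>, an open region containing \<open>x\<close>; these two open sets cover the
      space, so the pole of \<open>\<Gamma> x\<close> does no harm.\<close>
    have C1: "Ck_on 1 UNIV (F i)" for i
    proof -
      have "smooth_on (- {x}) (F i)"
        unfolding F_def
        using sm smooth_on_subset[OF \<phi>(1), of "- {x}"]
        by (intro smooth_on_diff smooth_on_mult smooth_on_flux H1 op) auto
      then have "Ck_on 1 (- {x}) (F i)" unfolding smooth_on_def by blast
      moreover have "Ck_on 1 (- K) (F i)"
        using Ck_on_cong[OF opK, of "\<lambda>_. 0" "F i" 1] FK by simp
      ultimately show ?thesis using Ck_on_Un[OF op opK] un by metis
    qed
    have int: "integrable lborel (pd i (F i))" "(\<integral>y. pd i (F i) y \<partial>lborel) = 0" for i
      using integral_partial_eq_0[OF C1, of "axis i 1" M i] FK KM by auto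
    \<comment> \<open>At the pole y = x every term vanishes because \<phi> is 0 nearby; elsewhere
      this is Green's identity.\<close>
    have id: "(\<Sum>i\<in>UNIV. pd i (F i) y) = \<Gamma> x y * Lop V A \<phi> y * V y - \<phi> y * f y" for y
    proof (cases "y = x")
      case True
      have "pd i (F i) x = 0" for i
        using partial_cong[OF opK xK, of "F i" "\<lambda>_. 0"] FK by simp
      moreover have "Lop V A \<phi> x = 0" using Lop_cong[OF opK xK \<phi>K] by simp
      ultimately show ?thesis using True \<phi>K[OF xK] by simp
    next
      case False
      then show ?thesis
        using Green_identity[OF H1 H2 op _ sm, of y \<phi>] \<phi>(1)
        by (simp add: F_def[abs_def] f_def smooth_on_subset)
    qed
    define h where "h y = \<phi> y * f y" for y
    have hK: "h y = 0" if "y \<in> - K" for y using \<phi>K[OF that] by (simp add: h_def)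
    have "continuous_on (- {x}) h"
      unfolding h_def using cf continuous_on_subset[OF smooth_on_imp_continuous_on[OF \<phi>(1)]]
      by (intro continuous_intros) auto
    moreover have "continuous_on (- K) h"
      using continuous_on_cong[of "- K" "- K" h "\<lambda>_. 0"] hK by simp
    ultimately have "continuous_on UNIV h"
      using continuous_on_open_Un[OF op opK, of h] un by simp
    then have inth: "integrable lborel h"
      using integrable_continuous_bounded_support[of h M] hK KM by blast
    have "(\<integral>y. (\<Sum>i\<in>UNIV. pd i (F i) y) + h y \<partial>lborel) = 0"
      using rep by (simp add: id h_def)
    moreover have "(\<integral>y. (\<Sum>i\<in>UNIV. pd i (F i) y) + h y \<partial>lborel) = (\<integral>y. h y \<partial>lborel)"
      using int inth by (subst Bochner_Integration.integral_add) auto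
    ultimately have h0: "(\<integral>y. h y \<partial>lborel) = 0" by simp
    have "0 < (\<integral>y. \<sigma> * h y \<partial>lborel)"
    proof (rule integral_continuous_pos[of _ UNIV a])
      show "integrable lborel (\<lambda>y. \<sigma> * h y)" using inth by simp
      show "continuous_on UNIV (\<lambda>y. \<sigma> * h y)"
        using \<open>continuous_on UNIV h\<close> by (intro continuous_intros)
      show "0 \<le> \<sigma> * h y" for y
      proof (cases "y \<in> K")
        case True
        then have "0 < \<sigma> * f y" using r(2) by (auto simp: K_def)
        then have "0 \<le> \<phi> y * (\<sigma> * f y)" using \<phi>(2)[of y] by simp
        then show ?thesis by (simp add: h_def mult.left_commute)
      qed (simp add: hK)
      have "a \<in> {x. \<phi> x \<noteq> 0}" using \<phi>(3) r(1) by simp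
      then have "0 < \<phi> a" using \<phi>(2)[of a] by simp
      moreover have "a \<in> cball a r" using r(1) by simp
      then have "0 < \<sigma> * f a" using r(2) by blast
      ultimately have "0 < \<phi> a * (\<sigma> * f a)" by (rule mult_pos_pos)
      then show "0 < \<sigma> * h a" by (simp add: h_def mult.left_commute)
    qed auto
    then show False using h0 by simp
  qed
qed

section \<open>Greedy mass distributions and Vitali selection\<close>

text \<open>
  The masses are assigned one after the other, each as large as the constraints permit.  Hence
  every index lies in a constraint that is already at least half exhausted when its turn is over,
  and this cannot be undone later.
\<close>

lemma greedy_masses:
  fixes \<C> :: "(nat set \<times> real) set" and \<beta> :: "nat \<Rightarrow> real"
  assumes ex: "\<And>n. \<exists>S b. (S, b) \<in> \<C> \<and> n \<in> S"
    and pos: "\<And>S b. (S, b) \<in> \<C> \<Longrightarrow> 0 \<le> b"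
    and \<beta>: "\<And>n. 0 < \<beta> n" "\<And>n S b. (S, b) \<in> \<C> \<Longrightarrow> n \<in> S \<Longrightarrow> \<beta> n \<le> b"
  obtains m :: "nat \<Rightarrow> real" where
    "\<And>n. 0 \<le> m n"
    "\<And>S b N. (S, b) \<in> \<C> \<Longrightarrow> (\<Sum>n | n < N \<and> n \<in> S. m n) \<le> b"
    "\<And>n. \<exists>S b. (S, b) \<in> \<C> \<and> n \<in> S \<and> b / 2 \<le> (\<Sum>k | k \<le> n \<and> k \<in> S. m k)"
proof -
  \<comment> \<open>The capacities left at \<open>n\<close> once the masses listed in
    \<open>xs\<close> are placed; the next mass is their infimum. The recursion builds lists because
    each step depends on all earlier masses.\<close>
  define slack where
    "slack xs n = {b - (\<Sum>k | k < length xs \<and> k \<in> S. xs ! k) | S b. (S, b) \<in> \<C> \<and> n \<in> S}"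
    for xs :: "real list" and n
  define L where "L = rec_nat [] (\<lambda>n xs. xs @ [Inf (slack xs n)])"
  have L0: "L 0 = []" and LS: "L (Suc n) = L n @ [Inf (slack (L n) n)]" for n
    by (simp_all add: L_def)
  have len: "length (L n) = n" for n by (induction n) (simp_all add: L0 LS)
  define m where "m n = L (Suc n) ! n" for n
  have Lnth: "k < n \<Longrightarrow> L n ! k = m k" for k n
  proof (induction n)
    case (Suc n)
    then show ?case by (cases "k = n") (simp_all add: LS nth_append len m_def)
  qed simp
  define T where "T S N = (\<Sum>k | k < N \<and> k \<in> S. m k)" for S N
  have sl: "slack (L n) n = {b - T S n | S b. (S, b) \<in> \<C> \<and> n \<in> S}" for n
    unfolding slack_def T_def len by (metis (no_types, lifting) Lnth mem_Collect_eq sum.cong)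
  have m: "m n = Inf {b - T S n | S b. (S, b) \<in> \<C> \<and> n \<in> S}" for n
    unfolding m_def LS by (simp add: nth_append len sl)
  have TS: "T S (Suc n) = T S n + (if n \<in> S then m n else 0)" for S n
  proof -
    have "{k. k < Suc n \<and> k \<in> S} =
      (if n \<in> S then insert n {k. k < n \<and> k \<in> S} else {k. k < n \<and> k \<in> S})"
      by (auto simp: less_Suc_eq)
    then show ?thesis by (simp add: T_def)
  qed
  have ne: "{b - T S n | S b. (S, b) \<in> \<C> \<and> n \<in> S} \<noteq> {}" for n using ex[of n] by blast
  \<comment> \<open>One induction proves both claims: feasibility before step \<open>N\<close> makes
    the slacks nonnegative, hence also the new mass. It also bounds them below, so the infimum is a
    true lower bound, which gives feasibility after the step.\<close>
  have feas: "(S, b) \<in> \<C> \<Longrightarrow> T S N \<le> b" and nonneg: "N' < N \<Longrightarrow> 0 \<le> m N'" for S b N N'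
  proof (induction N arbitrary: S b N')
    case 0
    {
      case 1
      then show ?case using pos by (simp add: T_def)
    next
      case 2
      then show ?case by simp
    }
  next
    case (Suc N)
    have mN: "0 \<le> m N" unfolding m using Suc.IH(1) by (intro cInf_greatest[OF ne]) auto
    {
      case 1
      have "m N \<le> b - T S N" if "N \<in> S"
        unfolding m using Suc.IH(1) 1 that
        by (intro cInf_lower bdd_belowI[of _ 0]) auto
      then show ?case using Suc.IH(1)[OF 1] by (auto simp: TS)
    next
      case 2
      then show ?case using Suc.IH(2) mN less_Suc_eq by auto
    }
  qed
  show thesis
  proof
    show "0 \<le> m n" for n using nonneg by blast
    show "(S, b) \<in> \<C> \<Longrightarrow> (\<Sum>n | n < N \<and> n \<in> S. m n) \<le> b" for S b N
      using feas unfolding T_def .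
    show "\<exists>S b. (S, b) \<in> \<C> \<and> n \<in> S \<and> b / 2 \<le> (\<Sum>k | k \<le> n \<and> k \<in> S. m k)" for n
    proof -
      \<comment> \<open>The infimum need not be attained, but some slack is within \<beta> n / 2 of
        it; as \<beta> n \<le> b, at most half of that constraint remains free after
        \<open>m n\<close> is placed.\<close>
      have "m n < m n + \<beta> n / 2" using \<beta>(1)[of n] by simp
      then obtain S b where Sb: "(S, b) \<in> \<C>" "n \<in> S" "b - T S n < m n + \<beta> n / 2"
        using cInf_lessD[OF ne] unfolding m by blast
      then have "b / 2 \<le> T S (Suc n)" using \<beta>(2)[OF Sb(1,2)] by (simp add: TS)
      then show ?thesis using Sb unfolding T_def less_Suc_eq_le by blast
    qed
  qed
qed

text \<open>Zorn's lemma gives a maximal disjoint family that is \<open>good\<close> for every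
  index. If some sets still met none of the chosen ones, one of them with \<open>s\<close> above
  half of their supremum could be added. No metric enters: in the application the sets
  \<open>C i\<close> consist of indices.\<close>

lemma Vitali_selection:
  fixes C :: "'i \<Rightarrow> 'a set" and s :: "'i \<Rightarrow> real"
  assumes ne: "\<And>i. i \<in> I \<Longrightarrow> C i \<noteq> {}" and s: "\<And>i. i \<in> I \<Longrightarrow> 0 < s i" "\<And>i. i \<in> I \<Longrightarrow> s i \<le> B"
  obtains J where "J \<subseteq> I" "disjoint_family_on C J"
    "\<And>i. i \<in> I \<Longrightarrow> \<exists>j\<in>J. C i \<inter> C j \<noteq> {} \<and> s i \<le> 2 * s j"
proof -
  \<comment> \<open>Each index is either free of the chosen sets or already served by one of at
    least half its size. In this form the property passes to unions of chains.\<close>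
  define good where "good J i \<longleftrightarrow> (\<forall>j\<in>J. C i \<inter> C j = {}) \<or> (\<exists>j\<in>J. C i \<inter> C j \<noteq> {} \<and> s i \<le> 2 * s j)"
    for J i
  define \<A> where "\<A> = {J. J \<subseteq> I \<and> disjoint_family_on C J \<and> (\<forall>i\<in>I. good J i)}"
  have "\<exists>M\<in>\<A>. \<forall>X\<in>\<A>. M \<subseteq> X \<longrightarrow> X = M"
  proof (rule subset_Zorn')
    fix \<D> assume ch: "subset.chain \<A> \<D>"
    then have sub: "\<D> \<subseteq> \<A>" by (simp add: subset.chain_def)
    have "disjoint_family_on C (\<Union>\<D>)"
      unfolding disjoint_family_on_def
    proof (intro ballI impI)
      fix i j assume "i \<in> \<Union>\<D>" "j \<in> \<Union>\<D>" and ij: "i \<noteq> j"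
      then obtain X Y where "X \<in> \<D>" "Y \<in> \<D>" "i \<in> X" "j \<in> Y" by blast
      moreover have "X \<subseteq> Y \<or> Y \<subseteq> X" using ch calculation unfolding subset_chain_def by blast
      ultimately obtain Z where "Z \<in> \<D>" "i \<in> Z" "j \<in> Z" by blast
      then show "C i \<inter> C j = {}"
        using sub ij unfolding \<A>_def disjoint_family_on_def by blast
    qed
    moreover have "good (\<Union>\<D>) i" if "i \<in> I" for i
    proof (cases "\<exists>X\<in>\<D>. \<exists>j\<in>X. C i \<inter> C j \<noteq> {}")
      case True
      then obtain X where "X \<in> \<D>" "\<exists>j\<in>X. C i \<inter> C j \<noteq> {}" by blast
      then have "\<exists>j\<in>X. C i \<inter> C j \<noteq> {} \<and> s i \<le> 2 * s j"
        using sub that unfolding \<A>_def good_def by blast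
      then show ?thesis using \<open>X \<in> \<D>\<close> unfolding good_def by blast
    next
      case False
      then show ?thesis unfolding good_def by blast
    qed
    moreover have "\<Union>\<D> \<subseteq> I" using sub unfolding \<A>_def by blast
    ultimately show "\<Union>\<D> \<in> \<A>" unfolding \<A>_def by blast
  qed
  then obtain J where J: "J \<in> \<A>" and max: "\<And>X. X \<in> \<A> \<Longrightarrow> J \<subseteq> X \<Longrightarrow> X = J" by blast
  define K where "K = {i \<in> I. \<forall>j\<in>J. C i \<inter> C j = {}}"
  have "K = {}"
  proof (rule ccontr)
    assume "K \<noteq> {}"
    then obtain i1 where i1: "i1 \<in> K" by blast
    have bdd: "bdd_above (s ` K)" using s(2) by (auto simp: K_def intro!: bdd_aboveI)
    have "0 < s i1" using i1 s(1) by (simp add: K_def)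
    also have "s i1 \<le> Sup (s ` K)" using i1 bdd by (intro cSup_upper) auto
    finally have "Sup (s ` K) / 2 < Sup (s ` K)" by simp
    then have "\<exists>y\<in>s ` K. Sup (s ` K) / 2 < y"
      using less_cSup_iff[OF _ bdd, of "Sup (s ` K) / 2"] \<open>K \<noteq> {}\<close> by blast
    then obtain i0 where i0: "i0 \<in> K" "Sup (s ` K) / 2 < s i0"
      by blast
    have big: "s i \<le> 2 * s i0" if "i \<in> K" for i
      using cSup_upper[of "s i" "s ` K"] that bdd i0(2) by auto
    have "insert i0 J \<in> \<A>"
      unfolding \<A>_def
    proof (intro CollectI conjI ballI)
      show "insert i0 J \<subseteq> I" using J i0 by (auto simp: \<A>_def K_def)
      show "disjoint_family_on C (insert i0 J)"
        using J i0 unfolding \<A>_def K_def disjoint_family_on_def by blast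
      fix i assume "i \<in> I"
      show "good (insert i0 J) i"
      proof (cases "i \<in> K")
        case True
        then show ?thesis using big unfolding good_def K_def by blast
      next
        case False
        then show ?thesis using J \<open>i \<in> I\<close> unfolding \<A>_def good_def K_def by blast
      qed
    qed
    from max[OF this] have "i0 \<in> J" by blast
    then have "C i0 \<inter> C i0 = {}" using i0(1) by (auto simp: K_def)
    then show False using ne i0(1) by (auto simp: K_def)
  qed
  show thesis
  proof
    show "J \<subseteq> I" "disjoint_family_on C J" using J by (auto simp: \<A>_def)
    show "\<exists>j\<in>J. C i \<inter> C j \<noteq> {} \<and> s i \<le> 2 * s j" if "i \<in> I" for i
      using J \<open>K = {}\<close> that unfolding \<A>_def good_def K_def by blast
  qed
qed

section \<open>Potentials and coverings in quasi-metric spaces\<close>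

locale quasi_metric =
  fixes d :: "'a \<Rightarrow> 'a \<Rightarrow> real" and \<kappa> :: real
  assumes \<kappa>: "1 < \<kappa>"
    and d_refl [simp]: "d x x = 0"
    and d_pos: "x \<noteq> y \<Longrightarrow> 0 < d x y"
    and d_sym: "d x y = d y x"
    and d_tri: "d x y \<le> \<kappa> * max (d x z) (d z y)"
begin

lemma d_nonneg [simp]: "0 \<le> d x y"
  using d_pos[of x y] by (cases "x = y") auto

lemma d_le: "d x z \<le> s \<Longrightarrow> d z y \<le> s \<Longrightarrow> d x y \<le> \<kappa> * s"
  using d_tri[of x y z] \<kappa> by (smt (verit) mult_left_mono)

text \<open>Here \<kappa> times \<open>d x y\<close> is at most half of \<open>d a y\<close>, so for
  positive \<open>d a y\<close> the maximum in the quasi-triangle inequality is attained by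
  \<open>d a x\<close>.\<close>

lemma d_comparable:
  assumes "d x y \<le> d a y / (2 * \<kappa>)"
  shows "d a y \<le> \<kappa> * d a x" "d a x \<le> \<kappa> * d a y"
proof -
  have "\<kappa> * d x y \<le> d a y / 2" using assms \<kappa> by (simp add: field_simps)
  then show "d a y \<le> \<kappa> * d a x"
    using d_tri[of a y x] d_nonneg[of a x] d_nonneg[of a y] \<kappa>
    by (smt (verit) field_sum_of_halves max_def mult_nonneg_nonneg)
  have "d a y / (2 * \<kappa>) \<le> d a y" using \<kappa> mult_mono[of 1 \<kappa> "d a y" "2 * d a y"] by (simp add: field_simps)
  then show "d a x \<le> \<kappa> * d a y"
    using assms by (intro d_le[of _ y]) (auto simp: d_sym)
qed

text \<open>The first entry compares the part of the potential from far points with its value at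
  \<open>a\<close>; the second is the sum of the geometric series of ratio
  \<open>2 powr (1 - p)\<close> that bounds the part from near points.\<close>

definition potential_const :: "real \<Rightarrow> real" where
  "potential_const p = max (2 * \<kappa> ^ 4)
     (2 * \<kappa> powr (2 * p - 1) * (1 / (2 * \<kappa> ^ 3)) powr (p - 1) / (1 - 2 powr (1 - p)))"

lemma potential_const_ge_1: "1 \<le> potential_const p"
proof -
  have "1 \<le> \<kappa> ^ 4" using \<kappa> by (intro one_le_power) auto
  then show ?thesis by (auto simp: potential_const_def)
qed

text \<open>
  The part of the potential coming from points close to \<open>z\<close> is summed over dyadic shells; the
  constraints make the shells contribute a geometric series.  For the other points \<open>d (x i) z\<close>
  is bounded below by a multiple of \<open>d a (x i)\<close>.
\<close>

lemma potential_bound: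
  fixes x :: "'i \<Rightarrow> 'a" and m \<rho> :: "'i \<Rightarrow> real"
  assumes p: "1 < p" and fin: "finite I"
    and m: "\<And>i. i \<in> I \<Longrightarrow> 0 \<le> m i" and \<rho>: "\<And>i. i \<in> I \<Longrightarrow> 0 < \<rho> i"
    and xa: "\<And>i. i \<in> I \<Longrightarrow> x i \<noteq> a"
    and cons: "\<And>i r. i \<in> I \<Longrightarrow> 0 < r \<Longrightarrow> r \<le> d a (x i) / (2 * \<kappa>) \<Longrightarrow>
      (\<Sum>j | j \<in> I \<and> d (x j) (x i) \<le> r \<and> \<rho> j \<le> r. m j) \<le> r powr p * d a (x i) powr (1 - p)"
    and z: "\<And>i. i \<in> I \<Longrightarrow> \<rho> i \<le> d (x i) z"
  shows "(\<Sum>i\<in>I. m i / d (x i) z) \<le> potential_const p * (1 + (\<Sum>i\<in>I. m i / d a (x i)))"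
proof -
  define S where "S = (\<Sum>i\<in>I. m i / d a (x i))"
  have S0: "0 \<le> S" unfolding S_def using m by (intro sum_nonneg) auto
  define q where "q = 2 powr (1 - p)"
  have q: "0 < q" "q < 1" using p by (auto simp: q_def powr_less_one)
  \<comment> \<open>The fraction of \<open>d a z\<close> up to which a point counts as near
    \<open>z\<close>. It makes \<kappa> times a shell radius at most
    \<open>d a (x k) / (2 * \<kappa>)\<close>, the largest radius of a constraint about
    \<open>x k\<close>.\<close>
  define b where "b = 1 / (2 * \<kappa> ^ 3)"
  have b: "0 < b" "b < 1"
    using \<kappa> one_less_power[OF \<kappa>, of 3] by (auto simp: b_def simp del: one_less_power)
  define K where "K = 2 * \<kappa> powr (2 * p - 1) * b powr (p - 1)"
  have K0: "0 \<le> K" by (simp add: K_def)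
  have pc: "potential_const p = max (2 * \<kappa> ^ 4) (K / (1 - q))"
    by (simp add: potential_const_def K_def q_def b_def)
  show ?thesis
  proof (cases "z = a")
    case True
    then have "(\<Sum>i\<in>I. m i / d (x i) z) = 1 * S" by (simp add: S_def d_sym)
    also have "\<dots> \<le> potential_const p * S"
      using potential_const_ge_1 S0 by (intro mult_right_mono) auto
    also have "\<dots> \<le> potential_const p * (1 + S)"
      using potential_const_ge_1[of p] by (intro mult_left_mono) auto
    finally show ?thesis by (simp add: S_def)
  next
    case False
    define g where "g = d a z"
    have g: "0 < g" using False d_pos by (simp add: g_def)
    have dz: "0 < d (x i) z" if "i \<in> I" for i using \<rho>[OF that] z[OF that] by simp
    define N where "N = {i \<in> I. d (x i) z \<le> b * g}"
    have "(\<Sum>i\<in>I - N. m i / d (x i) z) \<le> (\<Sum>i\<in>I - N. 2 * \<kappa> ^ 4 * (m i / d a (x i)))"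
    proof (rule sum_mono)
      fix i assume i: "i \<in> I - N"
      then have "g < d (x i) z / b" using b by (auto simp: N_def field_simps)
      moreover have "d (x i) z \<le> d (x i) z / b" using b by (simp add: field_simps mult_left_le_one_le)
      ultimately have "d a (x i) \<le> \<kappa> * (d (x i) z / b)"
        by (intro d_le[of _ z]) (auto simp: g_def d_sym)
      also have "\<dots> = 2 * \<kappa> ^ 4 * d (x i) z"
        by (simp add: b_def power3_eq_cube power4_eq_xxxx)
      finally have "d a (x i) \<le> 2 * \<kappa> ^ 4 * d (x i) z" .
      then have "m i * d a (x i) \<le> m i * (2 * \<kappa> ^ 4 * d (x i) z)"
        using m i by (intro mult_left_mono) auto
      moreover have "0 < d a (x i)" using xa[of i] d_pos[of a "x i"] i by auto
      ultimately show "m i / d (x i) z \<le> 2 * \<kappa> ^ 4 * (m i / d a (x i))"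
        using dz[of i] i by (simp add: field_simps)
    qed
    also have "\<dots> \<le> (\<Sum>i\<in>I. 2 * \<kappa> ^ 4 * (m i / d a (x i)))"
      using fin m \<kappa> by (intro sum_mono2) auto
    also have "\<dots> = 2 * \<kappa> ^ 4 * S" by (simp add: S_def sum_distrib_left)
    finally have far: "(\<Sum>i\<in>I - N. m i / d (x i) z) \<le> 2 * \<kappa> ^ 4 * S" .

    \<comment> \<open>The shell number of a near point: its distance from \<open>z\<close> is at
      most \<open>R j\<close> and greater than \<open>R j / 2\<close>.\<close>
    define sh where "sh i = nat \<lfloor>log 2 (b * g / d (x i) z)\<rfloor>" for i
    define R where "R j = b * g / 2 ^ j" for j :: nat
    have R0: "0 < R j" for j using b g by (simp add: R_def)
    have Rle: "R j \<le> b * g" for j using b g by (simp add: R_def field_simps)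
    have sh: "d (x i) z \<le> R (sh i)" "R (sh i) / 2 < d (x i) z" if "i \<in> N" for i
    proof -
      have dzi: "0 < d (x i) z" "d (x i) z \<le> b * g" using that dz by (auto simp: N_def)
      define t where "t = b * g / d (x i) z"
      have t: "1 \<le> t" using dzi by (simp add: t_def)
      have l0: "0 \<le> log 2 t" using t by simp
      have shl: "real (sh i) \<le> log 2 t" "log 2 t < real (sh i) + 1"
        using l0 unfolding sh_def t_def[symmetric] by linarith+
      have "2 ^ sh i = 2 powr real (sh i)" by (simp add: powr_realpow)
      also have "\<dots> \<le> 2 powr log 2 t" using shl by simp
      finally have 1: "2 ^ sh i \<le> t" using t by simp
      have "t = 2 powr log 2 t" using t by simp
      also have "\<dots> < 2 powr (real (sh i) + 1)" using shl by simp
      also have "\<dots> = 2 * 2 ^ sh i" by (simp add: powr_add powr_realpow)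
      finally have 2: "t < 2 * 2 ^ sh i" .
      show "d (x i) z \<le> R (sh i)" using 1 dzi by (simp add: R_def t_def field_simps)
      show "R (sh i) / 2 < d (x i) z" using 2 dzi by (simp add: R_def t_def field_simps)
    qed
    have shell: "(\<Sum>i\<in>{i \<in> N. sh i = j}. m i / d (x i) z) \<le> K * q ^ j" for j
    proof (cases "{i \<in> N. sh i = j} = {}")
      case True
      show ?thesis unfolding True using K0 q by simp
    next
      case False
      \<comment> \<open>Constraints exist only for balls about the points \<open>x i\<close>, so the
        shell is enclosed in one about a member \<open>x k\<close>, at the cost of a factor
        \<kappa>. Its points count there because \<rho> i \<le> d (x i) z \<le> R j.\<close>
      then obtain k where k: "k \<in> N" "sh k = j" by blast
      have kI: "k \<in> I" using k by (simp add: N_def)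
      have dk: "d (x k) z \<le> g / (2 * \<kappa>)"
      proof -
        have "b \<le> 1 / (2 * \<kappa>)"
          using \<kappa> self_le_power[of \<kappa> 3] by (simp add: b_def frac_le)
        then have "b * g \<le> 1 / (2 * \<kappa>) * g" using g by (intro mult_right_mono) auto
        then show ?thesis using k by (simp add: N_def)
      qed
      have gk: "g \<le> \<kappa> * d a (x k)" using d_comparable(1)[of "x k" z a] dk by (simp add: g_def)
      have xk: "0 < d a (x k)" using xa[OF kI] d_pos[of a "x k"] by auto
      have "\<kappa> * R j \<le> \<kappa> * (b * (\<kappa> * d a (x k)))"
        using Rle[of j] gk b \<kappa> by (smt (verit) mult_left_mono)
      also have "\<dots> = d a (x k) / (2 * \<kappa>)" using \<kappa> by (simp add: b_def power3_eq_cube)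
      finally have rad: "\<kappa> * R j \<le> d a (x k) / (2 * \<kappa>)" .
      have "(\<Sum>i\<in>{i \<in> N. sh i = j}. m i) \<le>
          (\<Sum>i | i \<in> I \<and> d (x i) (x k) \<le> \<kappa> * R j \<and> \<rho> i \<le> \<kappa> * R j. m i)"
      proof (rule sum_mono2)
        show "{i \<in> N. sh i = j} \<subseteq> {i \<in> I. d (x i) (x k) \<le> \<kappa> * R j \<and> \<rho> i \<le> \<kappa> * R j}"
        proof safe
          fix i assume i: "i \<in> N" "j = sh i"
          then show "i \<in> I" by (simp add: N_def)
          have di: "d (x i) z \<le> R j" "d z (x k) \<le> R j"
            using sh(1)[of i] sh(1)[of k] i k by (auto simp: d_sym)
          then show "d (x i) (x k) \<le> \<kappa> * R (sh i)" using i by (auto intro: d_le)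
          have "\<rho> i \<le> R j" using z[of i] di i by (simp add: N_def)
          also have "\<dots> \<le> \<kappa> * R j" using \<kappa> R0[of j] by simp
          finally show "\<rho> i \<le> \<kappa> * R (sh i)" using i by simp
        qed
      qed (use fin m in auto)
      also have "\<dots> \<le> (\<kappa> * R j) powr p * d a (x k) powr (1 - p)"
        using kI rad \<kappa> R0[of j] by (intro cons) auto
      also have "\<dots> \<le> (\<kappa> * R j) powr p * (g / \<kappa>) powr (1 - p)"
        using gk g \<kappa> p by (intro mult_left_mono powr_mono2') (auto simp: field_simps)
      finally have mass: "(\<Sum>i\<in>{i \<in> N. sh i = j}. m i) \<le> (\<kappa> * R j) powr p * (g / \<kappa>) powr (1 - p)" .
      have "(\<Sum>i\<in>{i \<in> N. sh i = j}. m i / d (x i) z) \<le> (\<Sum>i\<in>{i \<in> N. sh i = j}. 2 / R j * m i)"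
      proof (rule sum_mono)
        fix i assume i: "i \<in> {i \<in> N. sh i = j}"
        then have "m i * (R j / 2) \<le> m i * d (x i) z"
          using sh(2)[of i] m[of i] by (intro mult_left_mono) (auto simp: N_def)
        then show "m i / d (x i) z \<le> 2 / R j * m i"
          using dz[of i] i R0[of j] by (simp add: N_def field_simps)
      qed
      also have "\<dots> = 2 / R j * (\<Sum>i\<in>{i \<in> N. sh i = j}. m i)" by (simp add: sum_distrib_left)
      also have "\<dots> \<le> 2 / R j * ((\<kappa> * R j) powr p * (g / \<kappa>) powr (1 - p))"
        using mass R0[of j] by (intro mult_left_mono) auto
      \<comment> \<open>A mass of order R^p g^(1-p) at distance about R contributes the order (R /
        g)^(p-1), a constant multiple of q^j; p > 1 makes the series converge.\<close>
      also have "2 / R j * ((\<kappa> * R j) powr p * (g / \<kappa>) powr (1 - p)) = K * q ^ j"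
      proof -
        have "2 / R j * ((\<kappa> * R j) powr p * (g / \<kappa>) powr (1 - p)) =
            2 * (\<kappa> powr p / \<kappa> powr (1 - p)) * (R j powr p / R j powr 1) * g powr (1 - p)"
          using \<kappa> R0[of j] g by (simp add: powr_mult powr_divide mult_ac)
        also have "\<dots> = 2 * \<kappa> powr (2 * p - 1) * (R j powr (p - 1) * g powr (1 - p))"
          by (simp only: powr_diff[symmetric]) (simp add: algebra_simps)
        also have "R j powr (p - 1) = b powr (p - 1) * g powr (p - 1) / (2 ^ j) powr (p - 1)"
          using b g by (simp add: R_def powr_mult powr_divide)
        also have "(2 ^ j) powr (p - 1) = 1 / q ^ j"
          by (simp add: q_def powr_realpow[symmetric] powr_powr powr_diff powr_minus field_simps
              flip: powr_add)
        also have "b powr (p - 1) * g powr (p - 1) / (1 / q ^ j) * g powr (1 - p)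
            = b powr (p - 1) * q ^ j * (g powr (p - 1) * g powr (1 - p))" by simp
        also have "g powr (p - 1) * g powr (1 - p) = 1" using g by (simp add: powr_add[symmetric])
        finally show ?thesis by (simp add: K_def)
      qed
      finally show ?thesis .
    qed
    have finN: "finite N" using fin by (simp add: N_def)
    have "(\<Sum>j\<in>sh ` N. q ^ j) \<le> (\<Sum>j. q ^ j)"
      using q finN by (intro sum_le_suminf summable_geometric) auto
    also have "(\<Sum>j. q ^ j) = 1 / (1 - q)" using q by (intro suminf_geometric) auto
    finally have geo: "(\<Sum>j\<in>sh ` N. q ^ j) \<le> 1 / (1 - q)" .
    have "(\<Sum>i\<in>N. m i / d (x i) z) = (\<Sum>j\<in>sh ` N. \<Sum>i\<in>{i \<in> N. sh i = j}. m i / d (x i) z)"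
      using finN by (intro sum.group[symmetric]) auto
    also have "\<dots> \<le> (\<Sum>j\<in>sh ` N. K * q ^ j)" using shell by (intro sum_mono)
    also have "\<dots> = K * (\<Sum>j\<in>sh ` N. q ^ j)" by (simp add: sum_distrib_left)
    also have "\<dots> \<le> K * (1 / (1 - q))" using geo K0 by (intro mult_left_mono)
    finally have near: "(\<Sum>i\<in>N. m i / d (x i) z) \<le> K / (1 - q)" by simp
    have "(\<Sum>i\<in>I. m i / d (x i) z) = (\<Sum>i\<in>I - N. m i / d (x i) z) + (\<Sum>i\<in>N. m i / d (x i) z)"
      using fin by (intro sum.subset_diff) (auto simp: N_def)
    also have "\<dots> \<le> potential_const p * S + potential_const p"
      using far near S0 unfolding pc
      by (intro add_mono) (auto intro: order_trans[OF _ mult_right_mono[OF max.cobounded1]])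
    finally show ?thesis by (simp add: S_def algebra_simps)
  qed
qed

text \<open>The 2 stems from constraints that are only half exhausted, the factor \<kappa> from
  comparing distances to \<open>a\<close>, and 3 \<kappa>^4 is the dilation of the selected
  balls.\<close>

definition cover_const :: "real \<Rightarrow> real" where
  "cover_const p = 2 * \<kappa> * (3 * \<kappa> ^ 4) powr p"

lemma cover_const_pos: "0 < cover_const p"
  using \<kappa> by (simp add: cover_const_def)

text \<open>
  A point counts for a constraint ball only if its own scale \<open>\<rho> n\<close> does not exceed the radius.
  This is what allows infinitely many points with arbitrarily small scales.
\<close>

lemma masses_and_cover:
  fixes x :: "nat \<Rightarrow> 'a" and \<rho> :: "nat \<Rightarrow> real"
  assumes p: "1 < p" and xa: "\<And>n. x n \<noteq> a"
    and \<rho>: "\<And>n. 0 < \<rho> n" "\<And>n. \<rho> n \<le> d a (x n) / (2 * \<kappa>)"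
  obtains m where
    "\<And>n. 0 \<le> m n"
    "\<And>N z. (\<And>n. n < N \<Longrightarrow> \<rho> n \<le> d (x n) z) \<Longrightarrow>
       (\<Sum>n<N. m n / d (x n) z) \<le> potential_const p * (1 + (\<Sum>n<N. m n / d a (x n)))"
    "\<And>B. (\<And>N. (\<Sum>n<N. m n / d a (x n)) \<le> B) \<Longrightarrow>
       \<exists>(J :: nat set) c r. (\<forall>n\<in>J. 0 < r n \<and> c n \<noteq> a) \<and>
         (\<Union>n. {z. d (x n) z < \<rho> n}) \<subseteq> (\<Union>n\<in>J. {z. d (c n) z < r n}) \<and>
         (\<forall>F. finite F \<longrightarrow> F \<subseteq> J \<longrightarrow> (\<Sum>n\<in>F. (r n / d a (c n)) powr p) \<le> cover_const p * B)"
proof -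
  have ax: "0 < d a (x n)" for n using xa[of n] d_pos[of a "x n"] by auto
  define S where "S i r = {n. d (x n) (x i) \<le> r \<and> \<rho> n \<le> r}" for i r
  \<comment> \<open>The capacity is chosen so that \<open>bd i r / d a (x i)\<close> equals
    \<open>(r / d a (x i)) powr p\<close>, the term of this ball in the p-sum.\<close>
  define bd where "bd i r = r powr p * d a (x i) powr (1 - p)" for i r
  define \<C> where "\<C> = {(S i r, bd i r) | i r. 0 < r \<and> r \<le> d a (x i) / (2 * \<kappa>)}"
  \<comment> \<open>A lower bound for the capacity of every constraint containing \<open>n\<close>:
    there r \<ge> \<rho> n and d a (x i) \<le> \<kappa> * d a (x n), and the exponent 1 - p is
    negative.\<close>
  define \<beta> where "\<beta> n = \<rho> n powr p * (\<kappa> * d a (x n)) powr (1 - p)" for n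
  have \<C>: "(S i r, bd i r) \<in> \<C>" if "0 < r" "r \<le> d a (x i) / (2 * \<kappa>)" for i r
    using that by (auto simp: \<C>_def)
  obtain m where m: "\<And>n. 0 \<le> m n"
    "\<And>T b N. (T, b) \<in> \<C> \<Longrightarrow> (\<Sum>n | n < N \<and> n \<in> T. m n) \<le> b"
    "\<And>n. \<exists>T b. (T, b) \<in> \<C> \<and> n \<in> T \<and> b / 2 \<le> (\<Sum>k | k \<le> n \<and> k \<in> T. m k)"
  proof (rule greedy_masses[of \<C> \<beta>])
    show "\<exists>T b. (T, b) \<in> \<C> \<and> n \<in> T" for n
      using \<C>[of "\<rho> n" n] \<rho>[of n] by (intro exI[of _ "S n (\<rho> n)"]) (auto simp: S_def)
    show "0 \<le> b" if "(T, b) \<in> \<C>" for T b using that by (auto simp: \<C>_def bd_def)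
    show "0 < \<beta> n" for n
      unfolding \<beta>_def using \<rho>(1)[of n] ax[of n] \<kappa> by simp
    show "\<beta> n \<le> b" if Tb: "(T, b) \<in> \<C>" "n \<in> T" for n T b
    proof -
      obtain i r where ir: "T = S i r" "b = bd i r" "0 < r" "r \<le> d a (x i) / (2 * \<kappa>)"
        using Tb by (auto simp: \<C>_def)
      have n: "d (x n) (x i) \<le> r" "\<rho> n \<le> r" using Tb ir by (auto simp: S_def)
      have "d a (x i) \<le> \<kappa> * d a (x n)" using d_comparable(1)[of "x n" "x i" a] n ir by simp
      then show ?thesis
        unfolding \<beta>_def ir bd_def using n \<rho>(1)[of n] p ax[of i]
        by (intro mult_mono powr_mono2 powr_mono2') auto
    qed
  qed blast
  show thesis
  proof
    show "0 \<le> m n" for n by (fact m)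
    show "(\<Sum>n<N. m n / d (x n) z) \<le> potential_const p * (1 + (\<Sum>n<N. m n / d a (x n)))"
      if z: "\<And>n. n < N \<Longrightarrow> \<rho> n \<le> d (x n) z" for N z
    proof (rule potential_bound[OF p, where \<rho> = \<rho>])
      show "(\<Sum>j | j \<in> {..<N} \<and> d (x j) (x i) \<le> r \<and> \<rho> j \<le> r. m j) \<le> r powr p * d a (x i) powr (1 - p)"
        if "0 < r" "r \<le> d a (x i) / (2 * \<kappa>)" for i r
        using m(2)[OF \<C>[OF that], of N] by (simp add: S_def bd_def)
    qed (use m \<rho> z xa in auto)
    fix B assume B: "\<And>N. (\<Sum>n<N. m n / d a (x n)) \<le> B"
    define P where "P n i r \<longleftrightarrow> 0 < r \<and> r \<le> d a (x i) / (2 * \<kappa>) \<and> n \<in> S i r \<and>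
        bd i r / 2 \<le> (\<Sum>k | k \<le> n \<and> k \<in> S i r. m k)" for n i r
    have "\<exists>i r. P n i r" for n
    proof -
      obtain T b where "(T, b) \<in> \<C>" "n \<in> T" "b / 2 \<le> (\<Sum>k | k \<le> n \<and> k \<in> T. m k)"
        using m(3) by blast
      then show ?thesis by (auto simp: \<C>_def P_def)
    qed
    then obtain i r where "\<And>n. P n (i n) (r n)" by metis
    then have ir: "\<And>n. 0 < r n" "\<And>n. r n \<le> d a (x (i n)) / (2 * \<kappa>)"
        "\<And>n. n \<in> S (i n) (r n)"
        "\<And>n. bd (i n) (r n) / 2 \<le> (\<Sum>k | k \<le> n \<and> k \<in> S (i n) (r n). m k)"
      unfolding P_def by blast+
    define C where "C n = S (i n) (r n)" for n
    \<comment> \<open>The selection goes by relative radii, which are at most 1 / (2 * \<kappa>),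
      while the radii themselves may be unbounded. It makes the selected index sets disjoint, so
      that each mass is charged only once.\<close>
    define s where "s n = r n / d a (x (i n))" for n
    obtain J where J: "disjoint_family_on C J" "\<And>n. \<exists>j\<in>J. C n \<inter> C j \<noteq> {} \<and> s n \<le> 2 * s j"
    proof (rule Vitali_selection[of UNIV C s "1 / (2 * \<kappa>)"])
      show "C n \<noteq> {}" for n using ir(3)[of n] by (auto simp: C_def)
      show "0 < s n" for n using ir(1)[of n] ax by (simp add: s_def)
      show "s n \<le> 1 / (2 * \<kappa>)" for n using ir(2)[of n] ax[of "i n"] \<kappa> by (simp add: s_def field_simps)
    qed (auto intro: that)
    have comp: "d a (x (i n)) \<le> \<kappa> * d a (x k)" "d a (x k) \<le> \<kappa> * d a (x (i n))" if "k \<in> C n" for k n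
      using d_comparable[of "x k" "x (i n)" a] that ir(2)[of n] by (auto simp: C_def S_def)
    \<comment> \<open>Passing from relative to absolute radii costs 2 \<kappa>^2 and two nested uses
      of the quasi-triangle inequality cost another \<kappa>^2; 3 in place of 2 yields the strict
      inequality of open balls.\<close>
    define D where "D = 3 * \<kappa> ^ 4"
    have D: "0 < D" using \<kappa> by (simp add: D_def)
    show "\<exists>(J :: nat set) c r. (\<forall>n\<in>J. 0 < r n \<and> c n \<noteq> a) \<and>
         (\<Union>n. {z. d (x n) z < \<rho> n}) \<subseteq> (\<Union>n\<in>J. {z. d (c n) z < r n}) \<and>
         (\<forall>F. finite F \<longrightarrow> F \<subseteq> J \<longrightarrow> (\<Sum>n\<in>F. (r n / d a (c n)) powr p) \<le> cover_const p * B)"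
    proof (intro exI conjI ballI allI impI)
      show "0 < D * r n" "x (i n) \<noteq> a" for n using D ir(1) xa by auto
      show "(\<Union>n. {z. d (x n) z < \<rho> n}) \<subseteq> (\<Union>n\<in>J. {z. d (x (i n)) z < D * r n})"
      proof safe
        fix z n assume z: "d (x n) z < \<rho> n"
        obtain j l where j: "j \<in> J" "l \<in> C n" "l \<in> C j" "s n \<le> 2 * s j" using J(2)[of n] by blast
        have "d a (x (i n)) \<le> \<kappa> * (\<kappa> * d a (x (i j)))"
          using comp(1)[OF j(2)] comp(2)[OF j(3)] \<kappa> by (smt (verit) mult_left_mono)
        then have "s n * d a (x (i n)) \<le> 2 * s j * (\<kappa> * (\<kappa> * d a (x (i j))))"
          using j(4) ir(1)[of j] ax[of "i j"] by (intro mult_mono) (auto simp: s_def)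
        then have rr: "r n \<le> 2 * \<kappa>\<^sup>2 * r j"
          using ax[of "i n"] ax[of "i j"] by (simp add: s_def power2_eq_square mult_ac)
        define M where "M = 2 * \<kappa>\<^sup>2 * r j"
        have "1 \<le> \<kappa>\<^sup>2" using \<kappa> by (simp add: power2_eq_square less_1_mult less_imp_le)
        then have "r j \<le> M" using ir(1)[of j] by (simp add: M_def)
        have "d z (x (i n)) \<le> \<kappa> * M"
        proof (rule d_le)
          show "d z (x n) \<le> M"
            using z ir(3)[of n] rr by (simp add: S_def M_def d_sym)
          show "d (x n) (x (i n)) \<le> M" using ir(3)[of n] rr by (simp add: S_def M_def)
        qed
        moreover have "d (x (i n)) (x (i j)) \<le> \<kappa> * M"
        proof (rule d_le)
          show "d (x (i n)) (x l) \<le> M" using j(2) rr by (simp add: C_def S_def M_def d_sym)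
          show "d (x l) (x (i j)) \<le> M" using j(3) \<open>r j \<le> M\<close> by (simp add: C_def S_def)
        qed
        ultimately have "d z (x (i j)) \<le> \<kappa> * (\<kappa> * M)" by (rule d_le)
        also have "\<dots> = 2 * \<kappa> ^ 4 * r j" by (simp add: M_def power2_eq_square power4_eq_xxxx)
        also have "\<dots> < D * r j" using ir(1)[of j] \<kappa> by (simp add: D_def)
        finally show "z \<in> (\<Union>n\<in>J. {z. d (x (i n)) z < D * r n})" using j(1) by (auto simp: d_sym)
      qed
      fix F assume F: "finite F" "F \<subseteq> J"
      have term_le: "(D * r n / d a (x (i n))) powr p \<le>
          (\<Sum>k | k \<le> n \<and> k \<in> C n. cover_const p * (m k / d a (x k)))" for n
      proof -
        define y where "y = d a (x (i n))"
        have y: "0 < y" using ax by (simp add: y_def)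
        have "(D * r n / y) powr p = D powr p * (bd (i n) (r n) / y)"
          using y D ir(1)[of n]
          by (simp add: bd_def y_def[symmetric] powr_mult powr_divide powr_diff)
        also have "\<dots> \<le> D powr p * (2 * (\<Sum>k | k \<le> n \<and> k \<in> C n. m k) / y)"
          using ir(4)[of n] y by (intro mult_left_mono divide_right_mono) (auto simp: C_def)
        also have "\<dots> = (\<Sum>k | k \<le> n \<and> k \<in> C n. D powr p * 2 * (m k / y))"
          by (simp add: sum_distrib_left sum_divide_distrib mult_ac)
        also have "\<dots> \<le> (\<Sum>k | k \<le> n \<and> k \<in> C n. D powr p * 2 * (\<kappa> * (m k / d a (x k))))"
        proof (intro sum_mono mult_left_mono)
          fix k assume "k \<in> {k. k \<le> n \<and> k \<in> C n}"
          then have "d a (x k) \<le> \<kappa> * y" using comp(2)[of k n] by (simp add: y_def)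
          then have "m k * d a (x k) \<le> m k * (\<kappa> * y)" using m(1) by (intro mult_left_mono)
          then show "m k / y \<le> \<kappa> * (m k / d a (x k))"
            using y ax[of k] by (simp add: field_simps)
        qed auto
        finally show ?thesis by (simp add: y_def cover_const_def D_def mult_ac)
      qed
      obtain N where N: "\<And>n. n \<in> F \<Longrightarrow> n < N"
        using F(1) by (metis finite_nat_set_iff_bounded)
      have "(\<Sum>n\<in>F. (D * r n / d a (x (i n))) powr p) \<le>
          (\<Sum>n\<in>F. \<Sum>k | k \<le> n \<and> k \<in> C n. cover_const p * (m k / d a (x k)))"
        using term_le by (rule sum_mono)
      also have "\<dots> = (\<Sum>k\<in>(\<Union>n\<in>F. {k. k \<le> n \<and> k \<in> C n}). cover_const p * (m k / d a (x k)))"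
        using F J(1)
        by (intro sum.UNION_disjoint[symmetric]) (auto simp: disjoint_family_on_def)
      also have "\<dots> \<le> (\<Sum>k<N. cover_const p * (m k / d a (x k)))"
        using N m(1) less_imp_le[OF cover_const_pos] by (intro sum_mono2) (force intro: le_less_trans)+
      also have "\<dots> = cover_const p * (\<Sum>k<N. m k / d a (x k))" by (simp add: sum_distrib_left)
      also have "\<dots> \<le> cover_const p * B"
        using B less_imp_le[OF cover_const_pos] by (intro mult_left_mono)
      finally show "(\<Sum>n\<in>F. (D * r n / d a (x (i n))) powr p) \<le> cover_const p * B" .
    qed
  qed
qed

end

section \<open>The quasi-metric of a fundamental solution\<close>

lemma gam_refl [simp]: "gam \<Gamma> x x = 0"
  by (simp add: gam_def)

lemma gam_pos:
  assumes "FS V A \<Gamma>" "x \<noteq> y" shows "0 < gam \<Gamma> x y"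
  using assms by (simp add: FS_def gam_def)

text \<open>Contraposition of (G) with \<kappa> = 1 / \<theta>: if r = gam \<Gamma> x y exceeded the
  bound, \<open>z\<close> would lie in the balls of radius \<theta> r about \<open>x\<close> and
  about \<open>y\<close>, which are disjoint because \<open>x\<close> is outside
  \<open>gball \<Gamma> y r\<close>.\<close>

lemma quasi_metric_gam:
  assumes FS: "FS V A \<Gamma>" and G: "G \<Gamma>"
  obtains \<kappa> where "quasi_metric (gam \<Gamma>) \<kappa>"
proof -
  obtain \<theta> where \<theta>: "0 < \<theta>" "\<theta> < 1"
    "\<And>x y r. 0 < r \<Longrightarrow> x \<notin> gball \<Gamma> y r \<Longrightarrow> gball \<Gamma> x (\<theta> * r) \<inter> gball \<Gamma> y (\<theta> * r) = {}"
    using G unfolding G_def by metis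
  have sym: "gam \<Gamma> x y = gam \<Gamma> y x" for x y
    using FS by (cases "x = y") (auto simp: gam_def FS_def)
  have nonneg: "0 \<le> gam \<Gamma> x y" for x y
    using gam_pos[OF FS, of x y] by (cases "x = y") auto
  show thesis
  proof (rule that, unfold_locales)
    show "1 < 1 / \<theta>" using \<theta> by simp
    fix x y z
    show "gam \<Gamma> x x = 0" by simp
    show "0 < gam \<Gamma> x y" if "x \<noteq> y" using gam_pos[OF FS that] .
    show "gam \<Gamma> x y = gam \<Gamma> y x" by (fact sym)
    show "gam \<Gamma> x y \<le> 1 / \<theta> * max (gam \<Gamma> x z) (gam \<Gamma> z y)"
    proof (rule ccontr)
      define r where "r = gam \<Gamma> x y"
      assume "\<not> gam \<Gamma> x y \<le> 1 / \<theta> * max (gam \<Gamma> x z) (gam \<Gamma> z y)"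
      then have "max (gam \<Gamma> x z) (gam \<Gamma> z y) / \<theta> < r" by (simp add: r_def not_le)
      then have lt: "max (gam \<Gamma> x z) (gam \<Gamma> z y) < \<theta> * r"
        by (simp only: pos_divide_less_eq[OF \<theta>(1)] mult.commute)
      then have "0 < \<theta> * r" using nonneg[of x z] by linarith
      then have r: "0 < r" using \<theta>(1) by (simp add: zero_less_mult_iff)
      have "x \<notin> gball \<Gamma> y r" by (simp add: gball_def r_def sym)
      from \<theta>(3)[OF r this] have "z \<notin> gball \<Gamma> x (\<theta> * r) \<or> z \<notin> gball \<Gamma> y (\<theta> * r)" by blast
      then show False using lt by (auto simp: gball_def sym)
    qed
  qed
qed

lemma continuous_on_gam:
  assumes FS: "FS V A \<Gamma>"
  shows "continuous_on UNIV (gam \<Gamma> x)"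
proof (rule continuous_at_imp_continuous_on, rule ballI)
  fix y
  show "isCont (gam \<Gamma> x) y"
  proof (cases "y = x")
    case True
    have "filterlim (\<Gamma> x) at_top (at x)" using FS by (simp add: FS_def)
    then have "((\<lambda>y. inverse (\<Gamma> x y)) \<longlongrightarrow> 0) (at x)"
      by (rule filterlim_compose[OF tendsto_inverse_0_at_top, OF filterlim_ident, rotated])
    then have "(gam \<Gamma> x \<longlongrightarrow> 0) (at x)"
      by (rule Lim_transform_eventually) (auto simp: eventually_at_filter gam_def inverse_eq_divide)
    then show ?thesis using True by (simp add: isCont_def)
  next
    case False
    have "continuous_on (- {x}) (\<lambda>y. 1 / \<Gamma> x y)"
      using FS smooth_on_imp_continuous_on[OF smooth_on_Gamma[OF FS, of x]]
      by (intro continuous_intros) (auto simp: FS_def less_imp_neq[symmetric])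
    then have "continuous_on (- {x}) (gam \<Gamma> x)"
      by (rule continuous_on_eq) (auto simp: gam_def)
    then show ?thesis using False by (subst (asm) continuous_on_eq_continuous_at) auto
  qed
qed

lemma bounded_gam_le:
  assumes FS: "FS V A \<Gamma>"
  shows "bounded {y. gam \<Gamma> x y \<le> \<rho>}"
proof -
  define e where "e = 1 / (\<bar>\<rho>\<bar> + 1)"
  have "0 < e" by (simp add: e_def)
  moreover have "(\<Gamma> x \<longlongrightarrow> 0) at_infinity" using FS by (simp add: FS_def)
  ultimately have "eventually (\<lambda>y. \<Gamma> x y < e) at_infinity" by (simp add: order_tendsto_iff)
  then obtain b where b: "\<And>y. b \<le> norm y \<Longrightarrow> \<Gamma> x y < e"
    by (auto simp: eventually_at_infinity)
  have "norm y \<le> max b (norm x)" if "gam \<Gamma> x y \<le> \<rho>" for y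
  proof (rule ccontr)
    assume "\<not> norm y \<le> max b (norm x)"
    then have y: "\<Gamma> x y < e" "x \<noteq> y" using b by auto
    then have "0 < \<Gamma> x y" using FS by (simp add: FS_def)
    then have "\<bar>\<rho>\<bar> + 1 < 1 / \<Gamma> x y" using y(1) by (simp add: e_def field_simps)
    then show False using that y(2) by (simp add: gam_def)
  qed
  then show ?thesis by (auto simp: bounded_iff)
qed

text \<open>The closed ball of radius 1 about \<open>z\<close> is compact, so on its part outside
  \<open>E\<close> the function \<open>gam \<Gamma> z\<close> has a positive minimum.\<close>

lemma gam_le_subset_open:
  assumes FS: "FS V A \<Gamma>" and E: "open E" "z \<in> E"
  obtains \<rho> where "0 < \<rho>" "\<And>y. gam \<Gamma> z y \<le> \<rho> \<Longrightarrow> y \<in> E"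
proof -
  define K where "K = {y. gam \<Gamma> z y \<le> 1} - E"
  have "closed {y. gam \<Gamma> z y \<le> 1}"
    using continuous_on_gam[OF FS] by (intro closed_Collect_le) auto
  then have "compact {y. gam \<Gamma> z y \<le> 1}"
    using bounded_gam_le[OF FS] by (simp add: compact_eq_bounded_closed)
  then have K: "compact K" unfolding K_def using E(1) by (rule compact_diff)
  show thesis
  proof (cases "K = {}")
    case True
    then show thesis using that[of 1] by (auto simp: K_def)
  next
    case False
    obtain w where w: "w \<in> K" "\<And>y. y \<in> K \<Longrightarrow> gam \<Gamma> z w \<le> gam \<Gamma> z y"
      using continuous_attains_inf[OF K False continuous_on_subset[OF continuous_on_gam[OF FS]]] by blast
    have pos: "0 < gam \<Gamma> z w" using gam_pos[OF FS, of z w] w(1) E(2) by (auto simp: K_def)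
    show thesis
    proof (rule that[of "min 1 (gam \<Gamma> z w / 2)"])
      show "0 < min 1 (gam \<Gamma> z w / 2)" using pos by simp
      show "y \<in> E" if "gam \<Gamma> z y \<le> min 1 (gam \<Gamma> z w / 2)" for y
        using that w(2)[of y] pos by (force simp: K_def)
    qed
  qed
qed

section \<open>Comparison of a subharmonic function with a discrete potential\<close>

text \<open>The barrier is \<open>U - \<delta> / C * (P z - \<epsilon>)\<close> with the potential
  \<open>P\<close>. Since \<open>P\<close> tends to 0 at infinity, the condition P > \<epsilon>
  makes the comparison domain bounded; \<epsilon> tends to 0 afterwards.\<close>

lemma subharmonic_le_potential:
  fixes \<Gamma> :: "real^'n \<Rightarrow> real^'n \<Rightarrow> real" and u :: "real^'n \<Rightarrow> ereal"
  assumes H1: "H1 V A" and H2: "H2 A" and FS: "FS V A \<Gamma>"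
    and sub: "L_subharmonic_in V A UNIV u" and U: "\<And>z. u z \<le> ereal U"
    and I: "finite I" and m: "\<And>n. n \<in> I \<Longrightarrow> 0 \<le> m n"
    and \<rho>: "\<And>n. n \<in> I \<Longrightarrow> 0 < \<rho> n"
    and \<delta>: "0 < \<delta>" "\<And>n z. n \<in> I \<Longrightarrow> gam \<Gamma> (x n) z \<le> \<rho> n \<Longrightarrow> u z < ereal (U - \<delta>)"
    and C: "0 < C"
      "\<And>z. (\<And>n. n \<in> I \<Longrightarrow> \<rho> n \<le> gam \<Gamma> (x n) z) \<Longrightarrow> (\<Sum>n\<in>I. m n / gam \<Gamma> (x n) z) \<le> C"
    and x0: "ereal (U - \<delta>) \<le> u x0"
  shows "u x0 \<le> ereal (U - \<delta> / C * (\<Sum>n\<in>I. m n / gam \<Gamma> (x n) x0))"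
proof -
  define P where "P z = (\<Sum>n\<in>I. m n * \<Gamma> (x n) z)" for z
  \<comment> \<open>The complement of the balls in two versions: the comparison domain is an open
    part of \<open>D'\<close>, and its closure stays in the closed set \<open>D\<close>, where
    \<open>P\<close> has no poles and is at most \<open>C\<close>.\<close>
  define D where "D = {z. \<forall>n\<in>I. \<rho> n \<le> gam \<Gamma> (x n) z}"
  define D' where "D' = {z. \<forall>n\<in>I. \<rho> n < gam \<Gamma> (x n) z}"
  define X where "X = - (x ` I)"
  have opX: "open X" using I by (auto simp: X_def intro: finite_imp_closed)
  have DX: "D \<subseteq> X"
  proof
    fix z assume "z \<in> D"
    then have "0 < gam \<Gamma> (x n) z" if "n \<in> I" for n using that \<rho>[OF that] by (force simp: D_def)
    then show "z \<in> X" by (force simp: X_def)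
  qed
  have D'D: "D' \<subseteq> D" by (auto simp: D_def D'_def less_imp_le)
  have clD: "closed D"
  proof -
    have "D = (\<Inter>n\<in>I. {z. \<rho> n \<le> gam \<Gamma> (x n) z})" by (auto simp: D_def)
    also have "closed \<dots>"
      using continuous_on_gam[OF FS] by (intro closed_INT ballI closed_Collect_le) auto
    finally show ?thesis .
  qed
  have opD': "open D'"
  proof -
    have "D' = (\<Inter>n\<in>I. {z. \<rho> n < gam \<Gamma> (x n) z})" by (auto simp: D'_def)
    also have "open \<dots>"
      using I continuous_on_gam[OF FS] by (intro open_INT ballI open_Collect_less) auto
    finally show ?thesis .
  qed
  have PX: "P z = (\<Sum>n\<in>I. m n / gam \<Gamma> (x n) z)" if "z \<in> X" for z
    unfolding P_def using that by (intro sum.cong) (auto simp: X_def gam_def)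
  have harm: "L_harmonic_in V A X P"
    unfolding P_def
  proof (intro L_harmonic_in_sum L_harmonic_in_cmult H1 opX)
    show "L_harmonic_in V A X (\<Gamma> (x n))" if "n \<in> I" for n
      using L_harmonic_in_Gamma[OF H1 H2 FS] by (rule L_harmonic_in_subset) (use that in \<open>auto simp: X_def\<close>)
  qed
  then have contP: "continuous_on X P"
    by (auto simp: L_harmonic_in_def intro: smooth_on_imp_continuous_on)
  have limP: "(P \<longlongrightarrow> 0) at_infinity"
  proof -
    have "(P \<longlongrightarrow> (\<Sum>n\<in>I. m n * 0)) at_infinity"
      unfolding P_def[abs_def] using FS by (intro tendsto_sum tendsto_mult) (auto simp: FS_def)
    then show ?thesis by simp
  qed
  have x0D': "x0 \<in> D'"
    using \<delta>(2)[of _ x0] x0 by (force simp: D'_def not_le[symmetric])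
  have P0: "0 \<le> P x0"
    unfolding PX[OF subsetD[OF DX subsetD[OF D'D x0D']]]
    using m gam_pos[OF FS] by (intro sum_nonneg divide_nonneg_nonneg) (metis gam_refl less_imp_le order_refl)+
  have le: "u x0 \<le> ereal (U - \<delta> / C * (P x0 - \<epsilon>))" if \<epsilon>: "0 < \<epsilon>" "\<epsilon> < P x0" for \<epsilon>
  proof -
    define W where "W = {z \<in> D'. \<epsilon> < P z}"
    \<comment> \<open>On the boundary there are two cases: where P = \<epsilon> the barrier equals
      \<open>U\<close>; on the balls u < U - \<delta>, and there the barrier is at least U -
      \<delta> because P \<le> C.\<close>
    define h where "h z = (U + \<delta> / C * \<epsilon>) + - (\<delta> / C) * P z" for z
    have h: "h z = U - \<delta> / C * (P z - \<epsilon>)" for z by (simp add: h_def algebra_simps)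
    have opW: "open W"
      using continuous_open_preimage[OF continuous_on_subset[OF contP] opD', of "{\<epsilon><..}"] D'D DX
      by (auto simp: W_def vimage_def Int_def)
    have bW: "bounded W"
    proof -
      have "eventually (\<lambda>z. P z < \<epsilon>) at_infinity" using limP \<epsilon>(1) by (simp add: order_tendsto_iff)
      then obtain b where b: "\<And>z. b \<le> norm z \<Longrightarrow> P z < \<epsilon>" by (auto simp: eventually_at_infinity)
      have "norm z \<le> b" if "z \<in> W" for z
        using that b[of z] by (cases "b \<le> norm z") (auto simp: W_def)
      then show ?thesis by (auto simp: bounded_iff)
    qed
    have clW: "closure W \<subseteq> {z \<in> D. \<epsilon> \<le> P z}"
    proof (rule closure_minimal)
      show "W \<subseteq> {z \<in> D. \<epsilon> \<le> P z}" using D'D by (auto simp: W_def)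
      show "closed {z \<in> D. \<epsilon> \<le> P z}"
        using continuous_closed_preimage[OF continuous_on_subset[OF contP DX] clD, of "{\<epsilon>..}"]
        by (simp add: vimage_def Int_def)
    qed
    have "u z \<le> ereal (h z)" if "z \<in> W" for z
    proof -
      have "L_harmonic_in V A W h"
        unfolding h_def
        using L_harmonic_in_subset[OF harm, of W] D'D DX
        by (intro L_harmonic_in_add L_harmonic_in_cmult H1 opW) (auto simp: W_def)
      moreover have "continuous_on (closure W) h"
        unfolding h_def using clW DX
        by (intro continuous_intros continuous_on_subset[OF contP]) auto
      moreover have "u z \<le> ereal (h z)" if "z \<in> frontier W" for z
      proof -
        have z: "z \<in> D" "\<epsilon> \<le> P z" "z \<notin> W"
          using that clW opW by (auto simp: frontier_def interior_open)
        have PC: "P z \<le> C"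
          using C(2)[of z] z(1) DX PX[of z] by (auto simp: D_def)
        show ?thesis
        proof (cases "z \<in> D'")
          case True
          then have "P z = \<epsilon>" using z by (auto simp: W_def)
          then show ?thesis using U[of z] by (simp add: h)
        next
          case False
          then obtain n where "n \<in> I" "gam \<Gamma> (x n) z \<le> \<rho> n" by (auto simp: D'_def not_less)
          then have "u z < ereal (U - \<delta>)" by (rule \<delta>(2))
          moreover have "\<delta> / C * (P z - \<epsilon>) \<le> \<delta> / C * C"
            using PC \<epsilon>(1) \<delta>(1) C(1) by (intro mult_left_mono) auto
          then have "U - \<delta> \<le> h z" using C(1) by (simp add: h)
          ultimately show ?thesis by (meson ereal_less_eq(3) less_imp_le order_trans)
        qed
      qed
      ultimately show ?thesis
        using sub opW bW that unfolding L_subharmonic_in_def by blast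
    qed
    moreover have "x0 \<in> W" using x0D' \<epsilon> by (simp add: W_def)
    ultimately show ?thesis by (simp add: h)
  qed
  obtain v where v: "u x0 = ereal v"
    using x0 U[of x0] by (cases "u x0") auto
  have "v \<le> U - \<delta> / C * P x0"
  proof (rule field_le_epsilon)
    fix e :: real assume e: "0 < e"
    show "v \<le> U - \<delta> / C * P x0 + e"
    proof (cases "P x0 = 0")
      case True
      then show ?thesis using U[of x0] v e by simp
    next
      case False
      \<comment> \<open>The first entry keeps \<open>x0\<close> in the comparison domain, the second
        makes the error at most \<open>e\<close>.\<close>
      define \<epsilon> where "\<epsilon> = min (P x0 / 2) (e * C / \<delta>)"
      have \<epsilon>: "0 < \<epsilon>" "\<epsilon> < P x0" using False P0 e C \<delta>(1) by (auto simp: \<epsilon>_def min_less_iff_disj)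
      have "\<delta> / C * \<epsilon> \<le> \<delta> / C * (e * C / \<delta>)"
        using \<delta>(1) C(1) by (intro mult_left_mono) (auto simp: \<epsilon>_def)
      then have "\<delta> / C * \<epsilon> \<le> e" using \<delta>(1) C(1) by simp
      then show ?thesis using le[OF \<epsilon>] v by (simp add: algebra_simps)
    qed
  qed
  then show ?thesis
    using v PX[OF subsetD[OF DX subsetD[OF D'D x0D']]] by simp
qed

text \<open>This treats one level \<delta>. The masses sit in balls inside the sublevel set; if
  their potential at 0 exceeded \<open>B\<close>, comparison would push \<open>u x0\<close> below
  \<open>U - e\<close>, against the choice of \<open>x0\<close>.\<close>

lemma sublevel_cover:
  fixes \<Gamma> :: "real^'n \<Rightarrow> real^'n \<Rightarrow> real" and u :: "real^'n \<Rightarrow> ereal"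
  assumes H1: "H1 V A" and H2: "H2 A" and FS: "FS V A \<Gamma>" and G: "G \<Gamma>"
    and sub: "L_subharmonic_in V A UNIV u" and U: "\<And>z. u z \<le> ereal U"
    and sup: "\<And>e. 0 < e \<Longrightarrow> \<exists>x. ereal (U - e) < u x"
    and p: "1 < p" and \<delta>: "0 < \<delta>" and \<eta>: "0 < \<eta>"
  shows "\<exists>T (J :: nat set) c r. (\<forall>n\<in>J. 0 < r n \<and> c n \<noteq> 0) \<and>
    {z. u z < ereal (U - \<delta>) \<and> T < gam \<Gamma> 0 z} \<subseteq> (\<Union>n\<in>J. gball \<Gamma> (c n) (r n)) \<and>
    (\<forall>F. finite F \<longrightarrow> F \<subseteq> J \<longrightarrow> (\<Sum>n\<in>F. (r n / gam \<Gamma> 0 (c n)) powr p) \<le> \<eta>)"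
proof -
  obtain \<kappa> where qm: "quasi_metric (gam \<Gamma>) \<kappa>" using quasi_metric_gam[OF FS G] .
  interpret quasi_metric "gam \<Gamma>" \<kappa> by (fact qm)
  define B where "B = \<eta> / cover_const p"
  have B: "0 < B" using \<eta> cover_const_pos by (simp add: B_def)
  define c0 where "c0 = potential_const p"
  have c0: "1 \<le> c0" unfolding c0_def by (rule potential_const_ge_1)
  \<comment> \<open>Comparison lowers \<open>u x0\<close> below \<open>U\<close> by at least
    \<delta> / (\<kappa> * c0) times S / (1 + S), which increases with \<open>S\<close>; the second
    entry is its value at S = B. The first ensures u x0 > U - \<delta>, so that \<open>x0\<close> is
    off the balls.\<close>
  define e where "e = min \<delta> (\<delta> * B / (\<kappa> * c0 * (1 + B)))"
  have "0 < e" using \<delta> B c0 \<kappa> by (simp add: e_def)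
  then obtain x0 where x0: "ereal (U - e) < u x0" using sup by blast
  \<comment> \<open>Every \<open>x n\<close> will be farther from 0 than \<open>x0\<close>, so
    \<open>gam \<Gamma> (x n) x0\<close> is at most \<kappa> times
    \<open>gam \<Gamma> 0 (x n)\<close> and the potential at \<open>x0\<close> is at least S /
    \<kappa>.\<close>
  define T where "T = gam \<Gamma> 0 x0"
  define E where "E = {z. u z < ereal (U - \<delta>)}"
  define Y where "Y = {z. u z < ereal (U - \<delta>) \<and> T < gam \<Gamma> 0 z}"
  have "openin (top_of_set UNIV) {z \<in> UNIV. u z < ereal (U - \<delta>)}"
    using sub unfolding L_subharmonic_in_def usc_on_def by blast
  then have opE: "open E" by (simp add: E_def)
  have YE: "Y \<subseteq> E" by (auto simp: Y_def E_def)
  have Y0: "T < gam \<Gamma> 0 z" if "z \<in> Y" for z using that by (simp add: Y_def)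
  have T0: "0 \<le> T" by (simp add: T_def)
  show ?thesis
  proof (cases "Y = {}")
    case True
    then show ?thesis using \<eta> by (intro exI[of _ T] exI[of _ "{}"]) (auto simp: Y_def)
  next
    case False
    have "\<exists>\<rho>. 0 < \<rho> \<and> \<rho> \<le> gam \<Gamma> 0 z / (2 * \<kappa>) \<and> (\<forall>y. gam \<Gamma> z y \<le> \<rho> \<longrightarrow> y \<in> E)"
      if z: "z \<in> Y" for z
    proof -
      obtain \<rho> where \<rho>: "0 < \<rho>" "\<And>y. gam \<Gamma> z y \<le> \<rho> \<Longrightarrow> y \<in> E"
        using gam_le_subset_open[OF FS opE] YE z by blast
      have "0 < gam \<Gamma> 0 z / (2 * \<kappa>)" using Y0[OF z] T0 \<kappa> by simp
      then show ?thesis using \<rho> by (intro exI[of _ "min \<rho> (gam \<Gamma> 0 z / (2 * \<kappa>))"]) auto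
    qed
    then obtain \<rho> where \<rho>: "\<And>z. z \<in> Y \<Longrightarrow> 0 < \<rho> z" "\<And>z. z \<in> Y \<Longrightarrow> \<rho> z \<le> gam \<Gamma> 0 z / (2 * \<kappa>)"
        "\<And>z y. z \<in> Y \<Longrightarrow> gam \<Gamma> z y \<le> \<rho> z \<Longrightarrow> y \<in> E"
      by metis
    define O' where "O' z = {y. gam \<Gamma> z y < \<rho> z}" for z
    have "open (O' z)" for z
      unfolding O'_def using continuous_on_gam[OF FS] by (intro open_Collect_less) auto
    then have "\<And>S. S \<in> O' ` Y \<Longrightarrow> open S" by auto
    from Lindelof[OF this] obtain \<F>' where
      \<F>': "\<F>' \<subseteq> O' ` Y" "countable \<F>'" "\<Union>\<F>' = \<Union>(O' ` Y)" by metis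
    then obtain X where X: "X \<subseteq> Y" "countable X" "\<F>' = O' ` X"
      by (metis countable_subset_image)
    have "z \<in> O' z" if "z \<in> Y" for z using \<rho>(1)[OF that] by (simp add: O'_def)
    then have YX: "Y \<subseteq> (\<Union>z\<in>X. O' z)" using \<F>'(3) X(3) by blast
    then have "X \<noteq> {}" using False by blast
    \<comment> \<open>For finite \<open>X\<close> this enumeration repeats points; the masses belong
      to indices, so repetitions are harmless.\<close>
    define x where "x = from_nat_into X"
    have rx: "range x = X" unfolding x_def by (rule range_from_nat_into[OF \<open>X \<noteq> {}\<close> X(2)])
    have xY: "x n \<in> Y" for n using rx X(1) by auto
    have gx: "T < gam \<Gamma> 0 (x n)" for n using Y0[OF xY] .
    have xne0: "x n \<noteq> 0" for n using gx[of n] T0 by auto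
    have xx0: "x n \<noteq> x0" for n using gx[of n] by (auto simp: T_def)
    obtain m where m: "\<And>n. 0 \<le> m n"
      "\<And>N z. (\<And>n. n < N \<Longrightarrow> \<rho> (x n) \<le> gam \<Gamma> (x n) z) \<Longrightarrow>
         (\<Sum>n<N. m n / gam \<Gamma> (x n) z) \<le> c0 * (1 + (\<Sum>n<N. m n / gam \<Gamma> 0 (x n)))"
      "\<And>B. (\<And>N. (\<Sum>n<N. m n / gam \<Gamma> 0 (x n)) \<le> B) \<Longrightarrow>
         \<exists>(J :: nat set) c r. (\<forall>n\<in>J. 0 < r n \<and> c n \<noteq> 0) \<and>
           (\<Union>n. {z. gam \<Gamma> (x n) z < \<rho> (x n)}) \<subseteq> (\<Union>n\<in>J. {z. gam \<Gamma> (c n) z < r n}) \<and>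
           (\<forall>F. finite F \<longrightarrow> F \<subseteq> J \<longrightarrow>
              (\<Sum>n\<in>F. (r n / gam \<Gamma> 0 (c n)) powr p) \<le> cover_const p * B)"
    proof (rule masses_and_cover[OF p, of x 0 "\<lambda>n. \<rho> (x n)", folded c0_def], goal_cases)
      case (4 m)
      show ?case by (rule 4(1)[OF 4(2-4)])
    qed (use xne0 \<rho>(1,2)[OF xY] in auto)
    have "(\<Sum>n<N. m n / gam \<Gamma> 0 (x n)) \<le> B" for N
    proof (rule ccontr)
      define S where "S = (\<Sum>n<N. m n / gam \<Gamma> 0 (x n))"
      assume "\<not> (\<Sum>n<N. m n / gam \<Gamma> 0 (x n)) \<le> B"
      then have S: "B < S" by (simp add: S_def)
      define C where "C = c0 * (1 + S)"
      have C: "0 < C" using c0 B S by (simp add: C_def)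
      have "u x0 \<le> ereal (U - \<delta> / C * (\<Sum>n<N. m n / gam \<Gamma> (x n) x0))"
      proof (rule subharmonic_le_potential[OF H1 H2 FS sub U _ _ _ \<delta> _ C])
        show "u z < ereal (U - \<delta>)" if "gam \<Gamma> (x n) z \<le> \<rho> (x n)" for n z
          using \<rho>(3)[OF xY that] by (simp add: E_def)
        show "(\<Sum>n<N. m n / gam \<Gamma> (x n) z) \<le> C" if "\<And>n. n \<in> {..<N} \<Longrightarrow> \<rho> (x n) \<le> gam \<Gamma> (x n) z" for z
          using m(2)[of N z] that by (simp add: C_def S_def)
        show "ereal (U - \<delta>) \<le> u x0"
        proof -
          have "ereal (U - \<delta>) \<le> ereal (U - e)" by (simp add: e_def)
          also have "\<dots> \<le> u x0" using x0 by (rule less_imp_le)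
          finally show ?thesis .
        qed
      qed (use m \<rho>(1) xY in auto)
      with x0 have "ereal (U - e) < ereal (U - \<delta> / C * (\<Sum>n<N. m n / gam \<Gamma> (x n) x0))"
        by (rule less_le_trans)
      then have lt: "\<delta> / C * (\<Sum>n<N. m n / gam \<Gamma> (x n) x0) < e" by simp
      have "S / \<kappa> = (\<Sum>n<N. m n / gam \<Gamma> 0 (x n) / \<kappa>)" by (simp add: S_def sum_divide_distrib)
      also have "\<dots> \<le> (\<Sum>n<N. m n / gam \<Gamma> (x n) x0)"
      proof (rule sum_mono)
        fix n
        have "gam \<Gamma> (x n) x0 \<le> \<kappa> * gam \<Gamma> 0 (x n)"
          using gx[of n] by (intro d_le[of _ 0]) (auto simp: d_sym T_def)
        then have "m n / (\<kappa> * gam \<Gamma> 0 (x n)) \<le> m n / gam \<Gamma> (x n) x0"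
          using m(1)[of n] d_pos[OF xx0] \<kappa> gx[of n] T0
          by (intro divide_left_mono mult_pos_pos) auto
        then show "m n / gam \<Gamma> 0 (x n) / \<kappa> \<le> m n / gam \<Gamma> (x n) x0"
          by (simp add: mult.commute)
      qed
      finally have "\<delta> / C * (S / \<kappa>) < e"
        using lt C \<delta> by (smt (verit) divide_pos_pos mult_left_mono)
      also have "e \<le> \<delta> * B / (\<kappa> * c0 * (1 + B))" by (simp add: e_def)
      finally have "\<delta> / (\<kappa> * c0) * (S / (1 + S)) < \<delta> / (\<kappa> * c0) * (B / (1 + B))"
        by (simp add: C_def mult_ac)
      moreover have "0 < \<delta> / (\<kappa> * c0)" using \<delta> \<kappa> c0 by simp
      ultimately have "S / (1 + S) < B / (1 + B)" by (simp only: mult_less_cancel_left_pos)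
      then show False using S B by (simp add: field_simps)
    qed
    from m(3)[OF this] obtain J :: "nat set" and c r where J: "\<forall>n\<in>J. 0 < r n \<and> c n \<noteq> 0"
      "(\<Union>n. {z. gam \<Gamma> (x n) z < \<rho> (x n)}) \<subseteq> (\<Union>n\<in>J. {z. gam \<Gamma> (c n) z < r n})"
      "\<forall>F. finite F \<longrightarrow> F \<subseteq> J \<longrightarrow> (\<Sum>n\<in>F. (r n / gam \<Gamma> 0 (c n)) powr p) \<le> cover_const p * B"
      by (elim exE conjE) (rule that)
    have "cover_const p * B = \<eta>" using cover_const_pos[of p] by (simp add: B_def)
    moreover have "Y \<subseteq> (\<Union>n\<in>J. gball \<Gamma> (c n) (r n))"
    proof -
      have "(\<Union>z\<in>X. O' z) = (\<Union>n. {z. gam \<Gamma> (x n) z < \<rho> (x n)})"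
        unfolding rx[symmetric] O'_def by simp
      then show ?thesis using YX J(2) by (simp add: gball_def)
    qed
    ultimately show ?thesis
      using J(1,3) unfolding Y_def
      by (intro exI[of _ T] exI[of _ J] exI[of _ c] exI[of _ r]) simp
  qed
qed

section \<open>Assembly of the exceptional set\<close>

lemma pL_bounded_UN:
  fixes \<Gamma> :: "real^'n \<Rightarrow> real^'n \<Rightarrow> real" and F :: "nat \<Rightarrow> (real^'n) set"
    and J :: "nat \<Rightarrow> nat set"
  assumes J: "\<And>k n. n \<in> J k \<Longrightarrow> 0 < r k n \<and> c k n \<noteq> 0"
    and cov: "\<And>k. F k \<subseteq> (\<Union>n\<in>J k. gball \<Gamma> (c k n) (r k n))"
    and le: "\<And>k S. finite S \<Longrightarrow> S \<subseteq> J k \<Longrightarrow>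
      (\<Sum>n\<in>S. (r k n / gam \<Gamma> 0 (c k n)) powr p) \<le> (1 / 2) ^ k"
  shows "pL_bounded \<Gamma> p (\<Union>k. F k)"
proof -
  define I where "I = prod_encode ` (SIGMA k:UNIV. J k)"
  define c' where "c' i = (case prod_decode i of (k, n) \<Rightarrow> c k n)" for i
  define r' where "r' i = (case prod_decode i of (k, n) \<Rightarrow> r k n)" for i
  define t where "t k n = (r k n / gam \<Gamma> 0 (c k n)) powr p" for k n
  define f where "f i = (if c' i = 0 then (\<infinity>::ennreal) else ennreal ((r' i / gam \<Gamma> 0 (c' i)) powr p))" for i
  have pos: "\<forall>i\<in>I. r' i > 0" using J by (auto simp: I_def r'_def)
  have cover: "(\<Union>k. F k) \<subseteq> (\<Union>i\<in>I. gball \<Gamma> (c' i) (r' i))"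
  proof
    fix z assume "z \<in> (\<Union>k. F k)"
    then obtain k n where "n \<in> J k" "z \<in> gball \<Gamma> (c k n) (r k n)" using cov by blast
    then show "z \<in> (\<Union>i\<in>I. gball \<Gamma> (c' i) (r' i))"
      by (intro UN_I[of "prod_encode (k, n)"]) (auto simp: I_def c'_def r'_def)
  qed
  \<comment> \<open>In \<open>ennreal\<close> a common bound for the finite sums bounds the infinite
    one. Grouped by \<open>k\<close>, the terms form sums of at most 2^(-k); nonzero centres exclude
    infinite terms.\<close>
  have "sum f S \<le> 2" if S: "finite S" "S \<subseteq> I" for S
  proof -
    define D where "D = prod_decode ` S"
    have finD: "finite D" and DJ: "\<And>k n. (k, n) \<in> D \<Longrightarrow> n \<in> J k"
      using S by (auto simp: D_def I_def)
    have "sum f S = (\<Sum>d\<in>D. f (prod_encode d))"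
      unfolding D_def by (simp add: sum.reindex inj_prod_decode)
    also have "\<dots> = (\<Sum>(k, n)\<in>D. ennreal (t k n))"
      using J DJ by (intro sum.cong) (auto simp: f_def c'_def r'_def t_def)
    also have "\<dots> = ennreal (\<Sum>(k, n)\<in>D. t k n)"
      by (simp add: case_prod_beta' t_def sum_ennreal)
    also have "(\<Sum>(k, n)\<in>D. t k n) \<le> 2"
    proof -
      have Dk: "finite {n. (k, n) \<in> D}" for k
        using finite_vimageI[OF finD, of "Pair k"] by (auto simp: vimage_def inj_on_def)
      have "(\<Sum>k\<in>fst ` D. \<Sum>n\<in>{n. (k, n) \<in> D}. t k n) =
          (\<Sum>(k, n)\<in>(SIGMA k:fst ` D. {n. (k, n) \<in> D}). t k n)"
        using finD Dk by (intro sum.Sigma) auto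
      also have "(SIGMA k:fst ` D. {n. (k, n) \<in> D}) = D" by force
      finally have "(\<Sum>(k, n)\<in>D. t k n) = (\<Sum>k\<in>fst ` D. \<Sum>n\<in>{n. (k, n) \<in> D}. t k n)" ..
      also have "\<dots> \<le> (\<Sum>k\<in>fst ` D. (1 / 2) ^ k)"
        unfolding t_def using Dk DJ by (intro sum_mono le) auto
      also have "\<dots> \<le> (\<Sum>k. (1 / 2) ^ k)"
        using finD by (intro sum_le_suminf summable_geometric) auto
      also have "\<dots> = 2" by (subst suminf_geometric) auto
      finally show ?thesis .
    qed
    then have "ennreal (\<Sum>(k, n)\<in>D. t k n) \<le> ennreal 2" by (rule ennreal_leI)
    finally show ?thesis by simp
  qed
  then have "infsum f I \<le> 2"
    by (intro infsum_le_finite_sums nonneg_summable_on_complete) auto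
  then have "infsum f I < \<infinity>" by (rule le_less_trans) (simp add: ennreal_numeral_less_top)
  then show ?thesis
    unfolding pL_bounded_def f_def using pos cover by blast
qed

theorem theorem1p6:
  fixes V :: "real^'n \<Rightarrow> real"
    and A :: "real^'n \<Rightarrow> real^'n^'n"
    and \<Gamma> :: "real^'n \<Rightarrow> real^'n \<Rightarrow> real"
    and u :: "real^'n \<Rightarrow> ereal"
    and p :: real
  assumes "H1 V A" and "H2 A" and "H3 V A"
    and "FS V A \<Gamma>" and "G \<Gamma>" and "Liouville V A"
    and "u \<in> L_subharmonic_bdd V A UNIV"
    and "1 < p"
  shows "\<exists>F. pL_bounded \<Gamma> p F \<and> tendsto_at_infinity_off u (SUP x. u x) F"
proof -
  note H1 = \<open>H1 V A\<close> and FS = \<open>FS V A \<Gamma>\<close>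
  have sub: "L_subharmonic_in V A UNIV u" and "\<exists>M::real. \<forall>x. u x \<le> ereal M"
    using assms(7) by (auto simp: L_subharmonic_bdd_def)
  then obtain M :: real where M: "\<And>x. u x \<le> ereal M" by blast
  \<comment> \<open>Density of the points with u > -\<infinity> provides at least one; with the
    upper bound \<open>M\<close> the supremum is therefore a real number \<open>U\<close>.\<close>
  have "UNIV \<subseteq> closure {x \<in> UNIV. -\<infinity> < u x}"
    using sub unfolding L_subharmonic_in_def by blast
  then have "{x \<in> UNIV. -\<infinity> < u x} \<noteq> {}"
    by (metis closure_empty UNIV_not_empty subset_empty)
  then obtain w where w: "-\<infinity> < u w" by blast
  have "(SUP x. u x) \<le> ereal M" using M by (intro SUP_least)
  moreover have "-\<infinity> < (SUP x. u x)" using w SUP_upper[of w UNIV u] by (auto intro: less_le_trans)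
  ultimately obtain U where SU: "(SUP x. u x) = ereal U" by (cases "SUP x. u x") auto
  have U: "u z \<le> ereal U" for z unfolding SU[symmetric] by (rule SUP_upper) simp
  have sup: "\<exists>x. ereal (U - e) < u x" if "0 < e" for e
  proof -
    have "ereal (U - e) < (SUP x. u x)" using that by (simp add: SU)
    then show ?thesis by (simp add: less_SUP_iff)
  qed
  define \<delta> where "\<delta> k = inverse (real (Suc k))" for k
  have \<delta>: "0 < \<delta> k" for k by (simp add: \<delta>_def)
  have \<delta>_mono: "\<delta> j \<le> \<delta> k" if "k \<le> j" for j k using that by (simp add: \<delta>_def le_imp_inverse_le)
  define Q where "Q k T J c r \<longleftrightarrow> (\<forall>n\<in>J. 0 < r n \<and> c n \<noteq> 0) \<and>
    {z. u z < ereal (U - \<delta> k) \<and> T < gam \<Gamma> 0 z} \<subseteq> (\<Union>n\<in>J. gball \<Gamma> (c n) (r n)) \<and>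
    (\<forall>F. finite F \<longrightarrow> F \<subseteq> J \<longrightarrow> (\<Sum>n\<in>F. (r n / gam \<Gamma> 0 (c n)) powr p) \<le> (1 / 2) ^ k)"
    for k T and J :: "nat set" and c r
  have "\<exists>T J c r. Q k T J c r" for k
    unfolding Q_def using sublevel_cover[OF assms(1,2,4,5) sub U sup assms(8) \<delta>] by simp
  then obtain T J c r where Q: "\<And>k. Q k (T k) (J k) (c k) (r k)" by metis
  have cover:
    "\<And>k n. n \<in> J k \<Longrightarrow> 0 < r k n \<and> c k n \<noteq> 0"
    "\<And>k. {z. u z < ereal (U - \<delta> k) \<and> T k < gam \<Gamma> 0 z} \<subseteq> (\<Union>n\<in>J k. gball \<Gamma> (c k n) (r k n))"
    "\<And>k F. finite F \<Longrightarrow> F \<subseteq> J k \<Longrightarrow> (\<Sum>n\<in>F. (r k n / gam \<Gamma> 0 (c k n)) powr p) \<le> (1 / 2) ^ k"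
    using Q unfolding Q_def by blast+
  obtain X where X: "\<And>k. ereal (U - \<delta> k) < u (X k)" using sup[OF \<delta>] by metis
  \<comment> \<open>The sum makes \<open>R\<close> nondecreasing. Moreover \<open>R k\<close>
    dominates \<open>T k\<close>, so the cover applies beyond it;
    \<open>gam \<Gamma> 0 (X k)\<close>, so \<open>X k\<close> lies in the ball of radius
    \<open>R k\<close>; and \<open>k\<close>, so \<open>R\<close> is unbounded.\<close>
  define R where "R k = (\<Sum>i\<le>k. \<bar>T i\<bar> + \<bar>gam \<Gamma> 0 (X i)\<bar> + 1)" for k
  have R_mono: "R j \<le> R k" if "j \<le> k" for j k
    unfolding R_def using that by (intro sum_mono2) auto
  have R_T: "T k \<le> R k" and R_X: "gam \<Gamma> 0 (X k) < R k" for k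
  proof -
    have "\<bar>T k\<bar> + \<bar>gam \<Gamma> 0 (X k)\<bar> + 1 \<le> R k"
      unfolding R_def by (rule member_le_sum) auto
    then show "T k \<le> R k" "gam \<Gamma> 0 (X k) < R k" by linarith+
  qed
  have R_k: "real k \<le> R k" for k
  proof -
    have "real k \<le> (\<Sum>i\<le>k. 1)" by simp
    also have "\<dots> \<le> R k" unfolding R_def by (intro sum_mono) auto
    finally show ?thesis .
  qed
  define F where "F k = {z. u z < ereal (U - \<delta> k) \<and> R k < gam \<Gamma> 0 z}" for k
  have cont: "continuous_on UNIV (gam \<Gamma> 0)" by (rule continuous_on_gam[OF FS])
  have comparison: "u x \<le> ereal (h x)"
    if "open W" "bounded W" "L_harmonic_in V A W h" "continuous_on (closure W) h"
      "\<And>x. x \<in> frontier W \<Longrightarrow> u x \<le> ereal (h x)" "x \<in> W" for W h x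
    using sub that unfolding L_subharmonic_in_def by blast
  \<comment> \<open>Maximum principle on the ball of radius \<open>R k\<close> about 0: if
    \<open>u\<close> were below U - \<delta> k wherever \<open>gam \<Gamma> 0\<close> equals
    \<open>R k\<close>, this constant would bound \<open>u\<close> inside, against the choice of
    \<open>X k\<close>.\<close>
  have "\<exists>y. gam \<Gamma> 0 y = R k \<and> ereal (U - \<delta> k) \<le> u y" for k
  proof (rule ccontr)
    assume no: "\<nexists>y. gam \<Gamma> 0 y = R k \<and> ereal (U - \<delta> k) \<le> u y"
    define W where "W = {y. gam \<Gamma> 0 y < R k}"
    have opW: "open W" unfolding W_def using cont by (intro open_Collect_less) auto
    have "bounded W"
      by (rule bounded_subset[OF bounded_gam_le[OF FS, of 0 "R k"]]) (auto simp: W_def)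
    moreover have "u z \<le> ereal (U - \<delta> k)" if "z \<in> frontier W" for z
    proof -
      have "closure W \<subseteq> {y. gam \<Gamma> 0 y \<le> R k}"
        using cont by (intro closure_minimal closed_Collect_le) (auto simp: W_def)
      then have "gam \<Gamma> 0 z = R k"
        using that opW by (auto simp: frontier_def interior_open W_def)
      then show ?thesis using no by (auto simp: not_le intro: less_imp_le)
    qed
    moreover have "X k \<in> W" using R_X by (simp add: W_def)
    ultimately have "u (X k) \<le> ereal (U - \<delta> k)"
      using opW comparison[of W "\<lambda>_. U - \<delta> k"] by simp
    then show False using X[of k] by simp
  qed
  then obtain y where y: "\<And>k. gam \<Gamma> 0 (y k) = R k" "\<And>k. ereal (U - \<delta> k) \<le> u (y k)" by metis
  \<comment> \<open>As \<open>R\<close> is nondecreasing, \<open>F k\<close> can contain this point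
    only if k \<le> Suc j; then its level U - \<delta> k is not above U - \<delta> (Suc j), which
    \<open>u\<close> attains or exceeds there.\<close>
  have yF: "y (Suc j) \<notin> (\<Union>k. F k)" for j
  proof
    assume "y (Suc j) \<in> (\<Union>k. F k)"
    then obtain k where k: "u (y (Suc j)) < ereal (U - \<delta> k)" "R k < R (Suc j)"
      by (auto simp: F_def y)
    have "k \<le> Suc j" using R_mono[of "Suc j" k] k(2) by linarith
    then have "ereal (U - \<delta> k) \<le> ereal (U - \<delta> (Suc j))" using \<delta>_mono by simp
    then show False using y(2)[of "Suc j"] k(1) by (meson leD le_less_trans less_le_trans)
  qed
  have "\<not> bounded (- (\<Union>k. F k))"
  proof
    assume "bounded (- (\<Union>k. F k))"
    then have "compact (closure (- (\<Union>k. F k)))" by (simp add: compact_closure)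
    then have "bounded (gam \<Gamma> 0 ` closure (- (\<Union>k. F k)))"
      by (intro compact_imp_bounded compact_continuous_image continuous_on_subset[OF cont]) auto
    then obtain B where B: "\<And>z. z \<in> closure (- (\<Union>k. F k)) \<Longrightarrow> \<bar>gam \<Gamma> 0 z\<bar> \<le> B"
      by (auto simp: bounded_iff)
    obtain j :: nat where j: "B < real j" using reals_Archimedean2 by blast
    have "y (Suc j) \<in> closure (- (\<Union>k. F k))" by (rule subsetD[OF closure_subset ComplI[OF notE[OF yF]]])
    from B[OF this] show False using j R_k[of "Suc j"] by (simp add: y)
  qed
  moreover have "(u \<longlongrightarrow> ereal U) (inf at_infinity (principal (- (\<Union>k. F k))))"
  proof (rule order_tendstoI)
    fix b assume "ereal U < b"
    with U have "u x < b" for x by (rule le_less_trans)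
    then show "eventually (\<lambda>x. u x < b) (inf at_infinity (principal (- (\<Union>k. F k))))"
      by simp
  next
    fix a assume a: "a < ereal U"
    obtain k where k: "a < ereal (U - \<delta> k)"
    proof (cases a)
      case (real v)
      then have "0 < U - v" using a by simp
      then obtain k where "\<delta> k < U - v" unfolding \<delta>_def using reals_Archimedean by blast
      then show thesis using real by (intro that[of k]) simp
    qed (use a that[of 0] in auto)
    \<comment> \<open>Points of large norm satisfy gam \<Gamma> 0 x > R k; off \<open>F k\<close>
      this leaves only u x \<ge> U - \<delta> k.\<close>
    obtain b where b: "\<And>x. gam \<Gamma> 0 x \<le> R k \<Longrightarrow> norm x \<le> b"
      using bounded_gam_le[OF FS, of 0 "R k"] by (auto simp: bounded_iff)
    have "a < u x" if "x \<in> - (\<Union>k. F k)" "b + 1 \<le> norm x" for x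
    proof -
      have "R k < gam \<Gamma> 0 x" using b[of x] that(2) by force
      then have "ereal (U - \<delta> k) \<le> u x" using that(1) by (force simp: F_def not_less)
      then show ?thesis using k by simp
    qed
    then show "eventually (\<lambda>x. a < u x) (inf at_infinity (principal (- (\<Union>k. F k))))"
      unfolding eventually_inf_principal eventually_at_infinity by blast
  qed
  moreover have "pL_bounded \<Gamma> p (\<Union>k. F k)"
  proof (rule pL_bounded_UN[of J r c])
    have "F k \<subseteq> {z. u z < ereal (U - \<delta> k) \<and> T k < gam \<Gamma> 0 z}" for k
      using R_T[of k] by (auto simp: F_def)
    then show "F k \<subseteq> (\<Union>n\<in>J k. gball \<Gamma> (c k n) (r k n))" for k using cover(2) by blast
  qed (use cover in auto)
  ultimately show ?thesis unfolding tendsto_at_infinity_off_def SU by blast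
qed

end
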